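(* For each $m\ge1$, let $c_{2,m}$ be the number of move-equivalence classes of $(2,m)$-amplitrees. Then $$c_{2,m}=1^2+2^2+\dots+m^2=\frac{m(m+1)(2m+1)}{6},$$ and equivalently $\sum_{m\ge0}c_{2,m+1}x^m=\dfrac{1+x}{(1-x)^4}$.
   Context: A plabic tree is a plabic graph (planar graph in a disk, black/white internal vertices, boundary vertices $1,\dots,n$ labeled clockwise each incident to one edge, leafless) whose underlying graph is a tree; bipartite with boundary vertices $B_{bd}$ regarded as black and internal black vertices $B_{int}$; its type is $(k,n)$ with $k=1+\sum_{b\in B_{int}}(\deg b-2)$. A $(k,m)$-amplitree is a bipartite plabic tree of type $(k,km+1)$ which is $m$-balanced: for each edge $e$, writing $G\setminus\{e\}=G_1\sqcup G_2$ (each component receiving half of $e$), one has $1\le|B_{bd}\cap G_i|-m\sum_{b\in G_i\cap B_{int}}(\deg b-2)\le m$ for $i=1,2$ (degrees in $G$). Move-equivalence: generated by the plabic graph moves (square move; contracting/expanding adjacent internal vertices of the same color; inserting/removing degree-2 internal vertices); for trees only the latter two apply. *)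

theory Defs
  imports Main "HOL-Computational_Algebra.Formal_Power_Series"
begin

text \<open>
  A graph drawn in the disk is encoded, up to isotopy, by its rotation system:
  \<open>rot G v\<close> lists the neighbours of the vertex \<open>v\<close> in clockwise order, starting anywhere.
  A rotation system on simple graphs suffices because trees have no loops or multiple edges.
  The boundary vertex with label \<open>i\<close> is \<open>bd G ! (i - 1)\<close>; the internal black and the
  internal white vertices are \<open>blacks G\<close> and \<open>whites G\<close>.
\<close>

record 'v plabic =
  bd :: "'v list"
  blacks :: "'v set"
  whites :: "'v set"
  rot :: "'v \<Rightarrow> 'v list"

definition internal :: "'v plabic \<Rightarrow> 'v set" where
  "internal G = blacks G \<union> whites G"

definition verts :: "'v plabic \<Rightarrow> 'v set" where
  "verts G = set (bd G) \<union> internal G"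

definition adj :: "'v plabic \<Rightarrow> 'v \<Rightarrow> 'v \<Rightarrow> bool" where
  "adj G u v \<longleftrightarrow> u \<in> verts G \<and> v \<in> set (rot G u)"

definition deg :: "'v plabic \<Rightarrow> 'v \<Rightarrow> nat" where
  "deg G v = length (rot G v)"

definition rotation_system :: "'v plabic \<Rightarrow> bool" where
  "rotation_system G \<longleftrightarrow>
     finite (verts G) \<and> distinct (bd G) \<and>
     blacks G \<inter> whites G = {} \<and> set (bd G) \<inter> internal G = {} \<and>
     (\<forall>v\<in>verts G. distinct (rot G v) \<and> set (rot G v) \<subseteq> verts G - {v}) \<and>
     (\<forall>u v. adj G u v \<longrightarrow> adj G v u)"

definition is_cycle :: "'v plabic \<Rightarrow> 'v list \<Rightarrow> bool" where
  "is_cycle G p \<longleftrightarrow> 3 \<le> length p \<and> distinct p \<and>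
     (\<forall>i<length p. adj G (p ! i) (p ! (Suc i mod length p)))"

definition is_tree :: "'v plabic \<Rightarrow> bool" where
  "is_tree G \<longleftrightarrow> verts G \<noteq> {} \<and>
     (\<forall>u\<in>verts G. \<forall>v\<in>verts G. (adj G)\<^sup>*\<^sup>* u v) \<and> (\<nexists>p. is_cycle G p)"

definition cw_next :: "'v list \<Rightarrow> 'v \<Rightarrow> 'v \<Rightarrow> bool" where
  "cw_next xs x y \<longleftrightarrow> (\<exists>i<length xs. xs ! i = x \<and> xs ! (Suc i mod length xs) = y)"

text \<open>
  \<open>face_walk G p\<close>: the walk \<open>p\<close> follows the boundary of a region of the disk from one
  boundary vertex to the next one, i.e. having arrived at \<open>v\<close> from \<open>u\<close> it leaves \<open>v\<close> along
  the edge that follows \<open>vu\<close> clockwise, and it has no boundary vertex in its interior.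
\<close>

definition face_walk :: "'v plabic \<Rightarrow> 'v list \<Rightarrow> bool" where
  "face_walk G p \<longleftrightarrow> 2 \<le> length p \<and> adj G (p ! 0) (p ! 1) \<and>
     (\<forall>j. j + 2 < length p \<longrightarrow>
        p ! (j + 1) \<notin> set (bd G) \<and> cw_next (rot G (p ! (j + 1))) (p ! j) (p ! (j + 2)))"

text \<open>
  Every rotation system on a tree is realised by a drawing in the plane, unique up to isotopy.
  It can be drawn in the disk with the boundary vertices in clockwise order \<open>1, \<dots>, n\<close> on the
  circle iff the region next to the arc of the circle from \<open>i\<close> to \<open>i + 1\<close> (cyclically) is
  bounded by a walk in the tree from \<open>i\<close> to \<open>i + 1\<close>.
\<close>

definition boundary_clockwise :: "'v plabic \<Rightarrow> bool" where
  "boundary_clockwise G \<longleftrightarrow>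
     (\<forall>i<length (bd G). \<exists>p. face_walk G p \<and>
        hd p = bd G ! i \<and> last p = bd G ! (Suc i mod length (bd G)))"

definition plabic_tree :: "'v plabic \<Rightarrow> bool" where
  "plabic_tree G \<longleftrightarrow> rotation_system G \<and> is_tree G \<and> boundary_clockwise G \<and>
     (\<forall>v\<in>set (bd G). deg G v = 1) \<and> (\<forall>v\<in>internal G. deg G v \<noteq> 1)"

text \<open>Boundary vertices count as black for bipartiteness.\<close>

definition bipartite :: "'v plabic \<Rightarrow> bool" where
  "bipartite G \<longleftrightarrow>
     (\<forall>u v. adj G u v \<longrightarrow> (u \<in> set (bd G) \<union> blacks G) \<noteq> (v \<in> set (bd G) \<union> blacks G))"

definition has_type :: "'v plabic \<Rightarrow> nat \<Rightarrow> nat \<Rightarrow> bool" where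
  "has_type G k n \<longleftrightarrow>
     int k = 1 + (\<Sum>b\<in>blacks G. int (deg G b) - 2) \<and> n = length (bd G)"

text \<open>The vertices of the component of \<open>u\<close> after deleting the edge \<open>uv\<close>.\<close>

definition side :: "'v plabic \<Rightarrow> 'v \<Rightarrow> 'v \<Rightarrow> 'v set" where
  "side G u v = {x. (\<lambda>a b. adj G a b \<and> {a, b} \<noteq> {u, v})\<^sup>*\<^sup>* u x}"

text \<open>
  Adjacency is symmetric, so quantifying over ordered pairs covers both components.
  Degrees are taken in \<open>G\<close>: the deleted edge still counts as a half-edge.
\<close>

definition balanced :: "nat \<Rightarrow> 'v plabic \<Rightarrow> bool" where
  "balanced m G \<longleftrightarrow> (\<forall>u v. adj G u v \<longrightarrow>
     (let s = int (card (set (bd G) \<inter> side G u v))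
              - int m * (\<Sum>b\<in>side G u v \<inter> blacks G. int (deg G b) - 2)
      in 1 \<le> s \<and> s \<le> int m))"

definition amplitree :: "nat \<Rightarrow> nat \<Rightarrow> 'v plabic \<Rightarrow> bool" where
  "amplitree k m G \<longleftrightarrow>
     plabic_tree G \<and> bipartite G \<and> has_type G k (k * m + 1) \<and> balanced m G"

definition cyc_eq :: "'v list \<Rightarrow> 'v list \<Rightarrow> bool" where
  "cyc_eq xs ys \<longleftrightarrow> (\<exists>n. ys = rotate n xs)"

text \<open>Isotopy of drawings: renaming of the vertices that respects labels, colours and rotation.\<close>

definition isotopic :: "'v plabic \<Rightarrow> 'v plabic \<Rightarrow> bool" where
  "isotopic G H \<longleftrightarrow> (\<exists>f. bij_betw f (verts G) (verts H) \<and>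
     map f (bd G) = bd H \<and> f ` blacks G = blacks H \<and> f ` whites G = whites H \<and>
     (\<forall>v\<in>verts G. cyc_eq (map f (rot G v)) (rot H (f v))))"

text \<open>
  Contraction of an edge \<open>uv\<close> between internal vertices of the same colour; the merged vertex
  keeps the name \<open>u\<close>. Going clockwise around it one meets the neighbours of \<open>u\<close> after \<open>v\<close>,
  then those of \<open>v\<close> after \<open>u\<close>.
\<close>

definition contraction :: "'v plabic \<Rightarrow> 'v plabic \<Rightarrow> bool" where
  "contraction G H \<longleftrightarrow> (\<exists>u v xs ys.
     ({u, v} \<subseteq> blacks G \<or> {u, v} \<subseteq> whites G) \<and>
     cyc_eq (rot G u) (v # xs) \<and> cyc_eq (rot G v) (u # ys) \<and>
     H = \<lparr>bd = bd G, blacks = blacks G - {v}, whites = whites G - {v},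
          rot = (\<lambda>x. if x = u then xs @ ys
                     else map (\<lambda>y. if y = v then u else y) (rot G x))\<rparr>)"

text \<open>Removal of an internal vertex \<open>v\<close> of degree 2, of either colour, from the path \<open>a v b\<close>.\<close>

definition deg2_removal :: "'v plabic \<Rightarrow> 'v plabic \<Rightarrow> bool" where
  "deg2_removal G H \<longleftrightarrow> (\<exists>v a b.
     v \<in> internal G \<and> rot G v = [a, b] \<and>
     H = \<lparr>bd = bd G, blacks = blacks G - {v}, whites = whites G - {v},
          rot = (\<lambda>x. if x = a then map (\<lambda>y. if y = v then b else y) (rot G a)
                     else if x = b then map (\<lambda>y. if y = v then a else y) (rot G b)
                     else rot G x)\<rparr>)"

text \<open>
  The moves available on trees; expansion and insertion are the inverses, obtained by the
  symmetric closure. The intermediate plabic trees need not be bipartite.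
\<close>

definition move_equiv :: "'v plabic \<Rightarrow> 'v plabic \<Rightarrow> bool" where
  "move_equiv = equivclp (\<lambda>G H. plabic_tree G \<and> plabic_tree H \<and>
     (isotopic G H \<or> contraction G H \<or> deg2_removal G H))"

text \<open>
  Vertices are named by natural numbers; every finite graph is isotopic to one of this form.
\<close>

definition amplitree_classes :: "nat \<Rightarrow> nat \<Rightarrow> nat plabic set set" where
  "amplitree_classes k m =
     {G. amplitree k m G} //
       {(G, H). amplitree k m G \<and> amplitree k m H \<and> move_equiv G H}"

definition c :: "nat \<Rightarrow> nat \<Rightarrow> nat" where
  "c k m = card (amplitree_classes k m)"

end

theory Submission
  imports Defs
begin

text \<open>
  In type \<open>(2, n)\<close> the internal black degrees sum to one more than twice their number, so exactly one
  internal black vertex is trivalent and all others have degree 2. Removing a black vertex of degree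
  2 and contracting its two white neighbours leaves a tripod: the trivalent vertex with three white
  neighbours, each joined to a cyclic interval of boundary vertices. Two boundary vertices lie in
  the same interval iff deleting the trivalent vertex leaves them connected, a relation that all
  moves preserve. Balance says precisely that each interval has at most \<open>m\<close> elements, so
  the classes are the ways to cut a cycle of length \<open>2 * m + 1\<close> into three arcs of length at most \<open>m\<close>.
  A contraction of an edge, whatever the colours of its ends, preserves trees and faces; both moves
  are instances of it.
\<close>

subsection \<open>Cyclic lists\<close>

text \<open>The trees along a chain of moves may be neither bipartite nor balanced; only the number
  of labels and the sum of \<open>deg - 2\<close> over black vertices persist. So the invariant is
  built from these alone, and it is recorded in labels since a contraction may rename the trivalent
  vertex. Balance is likewise not followed through contractions: the bound on the arcs of the final
  tripod is read off the original tree, where the invariant has the same value. Conversely, a tripod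
  is balanced because the two loads at an edge add up to \<open>m + 1\<close>, which exchanges the
  bounds 1 and \<open>m\<close>. Acyclicity is restated by bridges and face walks by chains of
  directed edges; both become reachability statements, which a contraction respects one step at a
  time. Fixing the length \<open>j\<close> of the arc through the first boundary vertex leaves
  \<open>j\<close> positions for that vertex within the arc and \<open>j\<close> ways to divide the
  rest, whence the squares.\<close>

lemma cyc_eq_refl [simp]: "cyc_eq xs xs"
  unfolding cyc_eq_def by (metis rotate0 id_apply)

lemma cyc_eq_sym: "cyc_eq xs ys \<Longrightarrow> cyc_eq ys xs"
proof -
  assume "cyc_eq xs ys"
  then obtain n where n: "ys = rotate n xs" by (auto simp: cyc_eq_def)
  show "cyc_eq ys xs"
  proof (cases "xs = []")
    case True
    then show ?thesis using n by simp
  next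
    case False
    have "rotate (length xs - n mod length xs) ys
        = rotate (length xs - n mod length xs) (rotate (n mod length xs) xs)"
      using n rotate_conv_mod by metis
    also have "\<dots> = rotate (length xs) xs"
      using False by (simp add: rotate_rotate less_imp_le)
    finally show ?thesis
      unfolding cyc_eq_def by (metis rotate_id mod_self)
  qed
qed

lemma cyc_eq_trans: "cyc_eq xs ys \<Longrightarrow> cyc_eq ys zs \<Longrightarrow> cyc_eq xs zs"
  unfolding cyc_eq_def by (metis rotate_rotate)

lemma cyc_eq_map: "cyc_eq xs ys \<Longrightarrow> cyc_eq (map f xs) (map f ys)"
  unfolding cyc_eq_def by (metis rotate_map)

lemma cyc_eq_set: "cyc_eq xs ys \<Longrightarrow> set ys = set xs"
  and cyc_eq_length: "cyc_eq xs ys \<Longrightarrow> length ys = length xs"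
  and cyc_eq_distinct: "cyc_eq xs ys \<Longrightarrow> distinct ys \<longleftrightarrow> distinct xs"
  by (auto simp: cyc_eq_def)

lemma cyc_eq_append: "cyc_eq (xs @ ys) (ys @ xs)"
  unfolding cyc_eq_def by (metis rotate_append)

lemma cw_next_rotateD: "cw_next (rotate n xs) x y \<Longrightarrow> cw_next xs x y"
proof -
  assume "cw_next (rotate n xs) x y"
  then obtain i where i: "i < length xs" "rotate n xs ! i = x"
    "rotate n xs ! (Suc i mod length xs) = y" by (auto simp: cw_next_def)
  have "Suc i mod length xs < length xs" using i(1) by (intro mod_less_divisor) auto
  then have "xs ! ((n + i) mod length xs) = x" "xs ! (Suc ((n + i) mod length xs) mod length xs) = y"
    using i by (auto simp: nth_rotate mod_simps)
  moreover have "(n + i) mod length xs < length xs" using i(1) by (intro mod_less_divisor) auto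
  ultimately show ?thesis unfolding cw_next_def by blast
qed

lemma cw_next_cyc_eq: "cyc_eq xs ys \<Longrightarrow> cw_next xs x y \<longleftrightarrow> cw_next ys x y"
  by (metis cyc_eq_def cyc_eq_sym cw_next_rotateD)

lemma cw_next_map: "cw_next xs x y \<Longrightarrow> cw_next (map f xs) (f x) (f y)"
  unfolding cw_next_def
  by (metis (no_types, lifting) length_map nth_map mod_less_divisor less_nat_zero_code neq0_conv)

lemma cw_next_in: "cw_next xs x y \<Longrightarrow> x \<in> set xs \<and> y \<in> set xs"
  unfolding cw_next_def
  by (metis (no_types, lifting) nth_mem mod_less_divisor less_nat_zero_code neq0_conv)

lemma cw_next_append: "cw_next (ps @ x # y # qs) x y"
  unfolding cw_next_def by (rule exI[of _ "length ps"]) (auto simp: nth_append)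

lemma cw_next_wrap: "cw_next (y # ps @ [x]) x y"
  unfolding cw_next_def by (rule exI[of _ "Suc (length ps)"]) (auto simp: nth_append)

lemma cw_next_unique: "distinct xs \<Longrightarrow> cw_next xs x y \<Longrightarrow> cw_next xs x z \<Longrightarrow> y = z"
  unfolding cw_next_def by (metis nth_eq_iff_index_eq)

lemma cw_next_unique_pred: "distinct xs \<Longrightarrow> cw_next xs x y \<Longrightarrow> cw_next xs z y \<Longrightarrow> x = z"
proof -
  assume d: "distinct xs" and "cw_next xs x y" "cw_next xs z y"
  then obtain i j where ij: "i < length xs" "xs ! i = x" "xs ! (Suc i mod length xs) = y"
    "j < length xs" "xs ! j = z" "xs ! (Suc j mod length xs) = y" by (auto simp: cw_next_def)
  then have "Suc i mod length xs = Suc j mod length xs"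
    using nth_eq_iff_index_eq[OF d, of "Suc i mod length xs" "Suc j mod length xs"]
    by (metis mod_less_divisor not_less_zero neq0_conv)
  then have "i = j" using ij(1,4) by (auto simp: mod_Suc split: if_splits)
  then show ?thesis using ij by simp
qed

text \<open>In a contraction \<open>v\<close> is the neighbour to be merged, listed first. A turn at
  the vertex then comes from the contracted edge, enters it, or stays within \<open>xs\<close>;
  these are the cases.\<close>

lemma cw_next_Cons_cases:
  assumes "cw_next (v # xs) a e" "distinct (v # xs)" "xs \<noteq> []"
  obtains "a = v" "e = hd xs" | "a = last xs" "e = v"
    | ps qs where "xs = ps @ a # e # qs"
proof -
  from assms(1) obtain i where i: "i < Suc (length xs)" "(v # xs) ! i = a"
    "(v # xs) ! (Suc i mod Suc (length xs)) = e" by (auto simp: cw_next_def)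
  consider "i = 0" | "i = length xs" "i > 0" | j where "i = Suc j" "i < length xs"
    using i(1) assms(3) by (cases i) (auto simp: less_Suc_eq)
  then show ?thesis
  proof cases
    case 1
    then show ?thesis using i that(1) assms(3) by (auto simp: hd_conv_nth)
  next
    case 2
    then have "a = last xs" "e = v" using i assms(3) by (auto simp: last_conv_nth nth_Cons')
    then show ?thesis using that(2) by blast
  next
    case (3 j)
    then have "a = xs ! j" "e = xs ! Suc j" using i by auto
    then have "xs = take j xs @ a # e # drop (Suc (Suc j)) xs"
      using 3 by (metis Cons_nth_drop_Suc Suc_lessD append_take_drop_id)
    then show ?thesis using that(3) by blast
  qed
qed

text \<open>A cyclic list has no proper nonempty part that is closed under the successor.\<close>

lemma cyc_eq_if_cw_next:
  assumes "distinct xs" "distinct ys" "ys \<noteq> []"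
    and "\<And>i. i < length ys \<Longrightarrow> cw_next xs (ys ! i) (ys ! (Suc i mod length ys))"
  shows "cyc_eq ys xs"
proof -
  let ?n = "length xs" and ?m = "length ys"
  have m: "?m > 0" using assms(3) by simp
  have sub: "set ys \<subseteq> set xs"
    using assms(4) cw_next_in by (metis in_set_conv_nth subsetI)
  have le: "?m \<le> ?n"
    using card_mono[OF _ sub] distinct_card[OF assms(1)] distinct_card[OF assms(2)] by simp
  have n: "?n > 0" using m le by linarith
  obtain k where k: "k < ?n" "xs ! k = ys ! 0"
    using sub m by (metis in_set_conv_nth nth_mem subsetD)
  have *: "ys ! (i mod ?m) = xs ! ((k + i) mod ?n)" for i
  proof (induction i)
    case 0
    then show ?case using k by simp
  next
    case (Suc i)
    have "i mod ?m < ?m" using m by simp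
    from assms(4)[OF this] obtain l where l: "l < ?n" "xs ! l = ys ! (i mod ?m)"
      "xs ! (Suc l mod ?n) = ys ! (Suc i mod ?m)" by (auto simp: cw_next_def mod_Suc_eq)
    have "l = (k + i) mod ?n"
      using Suc l n assms(1) by (metis mod_less_divisor nth_eq_iff_index_eq)
    then show ?case using l by (simp add: mod_Suc_eq)
  qed
  \<comment> \<open>After \<open>length ys\<close> steps the walk is back at \<open>ys ! 0\<close>,
    hence at index \<open>k\<close> of \<open>xs\<close>; as \<open>ys\<close> is no longer than
    \<open>xs\<close>, it has gone round exactly once.\<close>
  have "xs ! ((k + ?m) mod ?n) = xs ! k" using *[of ?m] k by simp
  then have "(k + ?m) mod ?n = k"
    using nth_eq_iff_index_eq[OF assms(1) mod_less_divisor[OF n] k(1)] by blast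
  then have "?m = ?n" using le m k by (auto simp: mod_if split: if_splits)
  then have "ys = rotate k xs"
  proof (intro nth_equalityI)
    fix i assume "i < length ys"
    then show "ys ! i = rotate k xs ! i" using *[of i] \<open>?m = ?n\<close> by (simp add: nth_rotate)
  qed simp
  then show ?thesis unfolding cyc_eq_def using cyc_eq_sym cyc_eq_def by metis
qed

subsection \<open>Trees\<close>

lemma side_refl [simp]: "u \<in> side G u v"
  by (simp add: side_def)

lemma doubleton_neq: "a \<noteq> d \<Longrightarrow> b \<noteq> d \<Longrightarrow> {a, b} \<noteq> {e, d}"
  and doubleton_neq': "a \<noteq> d \<Longrightarrow> a \<noteq> e \<Longrightarrow> {a, b} \<noteq> {e, d}"
  by (auto simp: doubleton_eq_iff)

lemma side_step: "x \<in> side G u v \<Longrightarrow> adj G x y \<Longrightarrow> {x, y} \<noteq> {u, v} \<Longrightarrow> y \<in> side G u v"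
  unfolding side_def by (auto intro: rtranclp.rtrancl_into_rtrancl)

lemma side_induct [consumes 1, case_names base step]:
  assumes "x \<in> side G u v" "P u"
    "\<And>y z. y \<in> side G u v \<Longrightarrow> P y \<Longrightarrow> adj G y z \<Longrightarrow> {y, z} \<noteq> {u, v} \<Longrightarrow> P z"
  shows "P x"
proof -
  have "(\<lambda>a b. adj G a b \<and> {a, b} \<noteq> {u, v})\<^sup>*\<^sup>* u x" using assms(1) by (simp add: side_def)
  then show ?thesis
    by (induction rule: rtranclp_induct) (use assms(2,3) in \<open>auto simp: side_def\<close>)
qed

lemma adj_sym: "rotation_system G \<Longrightarrow> adj G u v \<Longrightarrow> adj G v u"
  and adj_verts: "rotation_system G \<Longrightarrow> adj G u v \<Longrightarrow> u \<in> verts G \<and> v \<in> verts G"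
  and adj_neq: "rotation_system G \<Longrightarrow> adj G u v \<Longrightarrow> u \<noteq> v"
  unfolding rotation_system_def adj_def by blast+

text \<open>Links reachability, as in \<open>side\<close>, to \<open>is_cycle\<close>, which asks
  for distinct vertices: prepending a vertex that already occurs cuts off the loop.\<close>

lemma rtranclp_distinct_path:
  assumes "R\<^sup>*\<^sup>* x y"
  shows "\<exists>p. p \<noteq> [] \<and> hd p = x \<and> last p = y \<and> distinct p \<and> successively R p"
  using assms
proof (induction rule: converse_rtranclp_induct)
  case base
  then show ?case by (intro exI[of _ "[y]"]) auto
next
  case (step x z)
  then obtain p where p: "p \<noteq> []" "hd p = z" "last p = y" "distinct p" "successively R p"
    by blast
  show ?case
  proof (cases "x \<in> set p")
    case True
    then obtain ps qs where "p = ps @ x # qs" by (meson split_list)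
    then show ?thesis using p by (intro exI[of _ "x # qs"]) (auto simp: successively_append_iff)
  next
    case False
    then show ?thesis using p step(1) by (intro exI[of _ "x # p"]) (auto simp: successively_Cons)
  qed
qed

text \<open>A path from \<open>u\<close> to \<open>v\<close> avoiding the edge \<open>uv\<close>
  closes up to a cycle, and a cycle supplies such a detour for one of its edges. The right side
  speaks of reachability only, which makes it manageable under contraction.\<close>

lemma acyclic_iff_bridges:
  fixes G :: "'a plabic"
  assumes "rotation_system G"
  shows "(\<nexists>p. is_cycle G p) \<longleftrightarrow> (\<forall>u v. adj G u v \<longrightarrow> v \<notin> side G u v)"
proof
  assume nc: "\<nexists>p. is_cycle G p"
  show "\<forall>u v. adj G u v \<longrightarrow> v \<notin> side G u v"
  proof (intro allI impI notI)
    fix u v assume uv: "adj G u v" and "v \<in> side G u v"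
    then have "(\<lambda>a b. adj G a b \<and> {a, b} \<noteq> {u, v})\<^sup>*\<^sup>* u v" by (simp add: side_def)
    from rtranclp_distinct_path[OF this] obtain p where p: "p \<noteq> []" "hd p = u" "last p = v"
      "distinct p" "successively (\<lambda>a b. adj G a b \<and> {a, b} \<noteq> {u, v}) p" by blast
    have s: "adj G (p ! i) (p ! Suc i)" "{p ! i, p ! Suc i} \<noteq> {u, v}" if "Suc i < length p" for i
      using p(5) that by (auto simp: successively_conv_nth)
    have ends: "p ! 0 = u" "p ! (length p - 1) = v"
      using p by (auto simp: hd_conv_nth last_conv_nth)
    \<comment> \<open>A path with one vertex would make \<open>uv\<close> a loop, and one with two
      vertices would be the forbidden edge itself.\<close>
    have "length p \<noteq> 1" using ends adj_neq[OF assms uv] by auto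
    moreover have "length p \<noteq> 2" using ends s(2)[of 0] by auto
    ultimately have len: "3 \<le> length p" using p(1) length_0_conv[of p] by linarith
    have "adj G (p ! i) (p ! (Suc i mod length p))" if "i < length p" for i
    proof (cases "Suc i < length p")
      case True
      then show ?thesis using s by simp
    next
      case False
      then have "Suc i = length p" using that by linarith
      then have "i = length p - 1" "Suc i mod length p = 0" by auto
      then show ?thesis using ends adj_sym[OF assms uv] by simp
    qed
    then show False using nc len p(4) unfolding is_cycle_def by blast
  qed
next
  assume br: "\<forall>u v. adj G u v \<longrightarrow> v \<notin> side G u v"
  show "\<nexists>p. is_cycle G p"
  proof
    assume "\<exists>p. is_cycle G p"
    then obtain p where p: "3 \<le> length p" "distinct p"
      "\<And>i. i < length p \<Longrightarrow> adj G (p ! i) (p ! (Suc i mod length p))" by (auto simp: is_cycle_def)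
    let ?u = "p ! 1" and ?v = "p ! 0"
    have s: "i \<ge> 1 \<Longrightarrow> i < length p \<Longrightarrow> p ! i \<in> side G ?u ?v" for i
    proof (induction i rule: nat_induct_at_least)
      case base
      then show ?case by simp
    next
      case (Suc i)
      then have "adj G (p ! i) (p ! Suc i)" using p(3)[of i] by simp
      moreover have "p ! i \<noteq> ?v" "p ! Suc i \<noteq> ?v"
        using Suc nth_eq_iff_index_eq[OF p(2), of i 0] nth_eq_iff_index_eq[OF p(2), of "Suc i" 0]
        by linarith+
      then have "{p ! i, p ! Suc i} \<noteq> {?u, ?v}" by (rule doubleton_neq)
      ultimately show ?case using side_step Suc by (metis Suc_lessD)
    qed
    obtain l where l: "length p = Suc l" "l \<ge> 2" using p(1) by (cases "length p") auto
    have 1: "p ! l \<in> side G ?u ?v" using s l by simp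
    have 2: "adj G (p ! l) ?v" using p(3)[of l] l(1) by simp
    have "p ! l \<noteq> ?u" using nth_eq_iff_index_eq[OF p(2), of l 1] l by simp
    with adj_neq[OF assms 2] have "{p ! l, ?v} \<noteq> {?u, ?v}" by (rule doubleton_neq')
    from side_step[OF 1 2 this] have "?v \<in> side G ?u ?v" .
    moreover have "Suc 0 mod length p = 1" "0 < length p" using l by auto
    then have "adj G ?v ?u" using p(3)[of 0] by simp
    then have "adj G ?u ?v" by (rule adj_sym[OF assms])
    ultimately show False using br by blast
  qed
qed

subsection \<open>Faces as chains of darts\<close>

text \<open>A pair is a directed edge (a dart), and \<open>step\<close> is the face successor:
  arrive along \<open>d\<close>, leave along the next edge clockwise. Chains stop at boundary
  vertices.\<close>

definition step :: "'v plabic \<Rightarrow> 'v \<times> 'v \<Rightarrow> 'v \<times> 'v \<Rightarrow> bool" where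
  "step G d e \<longleftrightarrow>
     snd d = fst e \<and> fst e \<notin> set (bd G) \<and> cw_next (rot G (fst e)) (fst d) (snd e)"

lemma step_pair [simp]:
  "step G (a, x) (y, b) \<longleftrightarrow> x = y \<and> y \<notin> set (bd G) \<and> cw_next (rot G y) a b"
  by (auto simp: step_def)

lemma face_walk_imp_step:
  assumes "face_walk G p"
  shows "\<exists>x y. adj G (hd p) x \<and> (step G)\<^sup>*\<^sup>* (hd p, x) (y, last p)"
proof -
  have len: "2 \<le> length p" and a: "adj G (p ! 0) (p ! 1)"
    and s: "\<And>j. j + 2 < length p \<Longrightarrow> p ! (j + 1) \<notin> set (bd G) \<and>
      cw_next (rot G (p ! (j + 1))) (p ! j) (p ! (j + 2))"
    using assms by (auto simp: face_walk_def)
  have "Suc j < length p \<Longrightarrow> (step G)\<^sup>*\<^sup>* (p ! 0, p ! 1) (p ! j, p ! Suc j)" for j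
  proof (induction j)
    case (Suc j)
    then have "step G (p ! j, p ! Suc j) (p ! Suc j, p ! Suc (Suc j))"
      using s[of j] by simp
    then show ?case using Suc by (meson Suc_lessD rtranclp.rtrancl_into_rtrancl)
  qed simp
  moreover obtain l where l: "length p = l + 2" using len by (metis add.commute le_Suc_ex)
  ultimately have "(step G)\<^sup>*\<^sup>* (p ! 0, p ! 1) (p ! l, p ! Suc l)" by simp
  moreover have "p \<noteq> []" using l by auto
  then have "hd p = p ! 0" "last p = p ! Suc l"
    using l by (auto simp: hd_conv_nth last_conv_nth)
  ultimately show ?thesis using a by metis
qed

text \<open>The last two vertices determine the next turn, so the induction also keeps track of the
  last but one.\<close>

lemma step_imp_face_walk:
  assumes "(step G)\<^sup>*\<^sup>* d e" "adj G (fst d) (snd d)"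
  shows "\<exists>p. face_walk G (fst d # p @ [snd e]) \<and> last (fst d # p) = fst e"
  using assms(1)
proof (induction rule: rtranclp_induct)
  case base
  then show ?case using assms(2) by (intro exI[of _ "[]"]) (auto simp: face_walk_def)
next
  case (step e f)
  then obtain p where p: "face_walk G (fst d # p @ [snd e])" "last (fst d # p) = fst e"
    by blast
  let ?p = "fst d # p" and ?q = "fst d # (p @ [snd e]) @ [snd f]"
  have q: "?q ! j = (?p @ [snd e]) ! j" if "j < length p + 2" for j
    using that by (auto simp: nth_append nth_Cons')
  have "face_walk G ?q"
    unfolding face_walk_def
  proof (intro conjI allI impI)
    show "2 \<le> length ?q" by simp
    show "adj G (?q ! 0) (?q ! 1)"
      using p(1) unfolding face_walk_def q[of 0, simplified] by (simp add: nth_append split: if_splits)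
    fix j assume j: "j + 2 < length ?q"
    have "?q ! (j + 1) \<notin> set (bd G) \<and> cw_next (rot G (?q ! (j + 1))) (?q ! j) (?q ! (j + 2))"
    proof (cases "j + 2 < length p + 2")
      case True
      then have "?q ! j = (?p @ [snd e]) ! j" "?q ! (j + 1) = (?p @ [snd e]) ! (j + 1)"
        "?q ! (j + 2) = (?p @ [snd e]) ! (j + 2)" by (intro q; simp)+
      then show ?thesis using p(1) True unfolding face_walk_def by simp
    next
      case False
      then have j: "j = length p" using j by simp
      have "?q ! (j + 1) = snd e" "?q ! (j + 2) = snd f"
        using j by (simp_all add: nth_append)
      moreover have "?q ! j = last ?p"
        using j by (cases p rule: rev_cases) (simp_all add: nth_append)
      ultimately show ?thesis using step(2) p(2) by (simp add: step_def)
    qed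
    then show "?q ! (j + 1) \<notin> set (bd G)" "cw_next (rot G (?q ! (j + 1))) (?q ! j) (?q ! (j + 2))"
      by blast+
  qed
  then show ?case using step(2) by (intro exI[of _ "p @ [snd e]"]) (simp add: step_def)
qed

lemma boundary_clockwise_iff_step:
  "boundary_clockwise G \<longleftrightarrow> (\<forall>i<length (bd G). \<exists>x y. adj G (bd G ! i) x \<and>
     (step G)\<^sup>*\<^sup>* (bd G ! i, x) (y, bd G ! (Suc i mod length (bd G))))"
proof -
  have "(\<exists>p. face_walk G p \<and> hd p = s \<and> last p = t) \<longleftrightarrow>
    (\<exists>x y. adj G s x \<and> (step G)\<^sup>*\<^sup>* (s, x) (y, t))" for s t
  proof
    assume "\<exists>p. face_walk G p \<and> hd p = s \<and> last p = t"
    then show "\<exists>x y. adj G s x \<and> (step G)\<^sup>*\<^sup>* (s, x) (y, t)"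
      using face_walk_imp_step by blast
  next
    assume "\<exists>x y. adj G s x \<and> (step G)\<^sup>*\<^sup>* (s, x) (y, t)"
    then obtain p where "face_walk G (s # p @ [t])"
      using step_imp_face_walk[of G "(s, _)" "(_, t)"] by auto
    then show "\<exists>p. face_walk G p \<and> hd p = s \<and> last p = t"
      by (intro exI[of _ "s # p @ [t]"]) simp
  qed
  then show ?thesis by (simp add: boundary_clockwise_def)
qed

text \<open>One step may be matched by none or several, as happens when the contracted edge is
  traversed. For faces, \<open>I\<close> carries the fact that darts are edges.\<close>

lemma rtranclp_simulation:
  assumes "R\<^sup>*\<^sup>* x y" "I x" "\<And>a b. I a \<Longrightarrow> R a b \<Longrightarrow> I b \<and> S\<^sup>*\<^sup>* (f a) (f b)"
  shows "S\<^sup>*\<^sup>* (f x) (f y)"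
proof -
  from assms(1) have "I y \<and> S\<^sup>*\<^sup>* (f x) (f y)"
  proof (induction rule: rtranclp_induct)
    case base
    then show ?case using assms(2) by simp
  next
    case (step a b)
    then show ?case using assms(3)[of a b] by (meson rtranclp_trans)
  qed
  then show ?thesis ..
qed

subsection \<open>Contracting an edge of a tree\<close>

text \<open>Covers both moves. \<open>u\<close> may be a boundary vertex, since a removed vertex of
  degree 2 may be adjacent to one, whereas \<open>v\<close> disappears and must be internal.
  Rotations are prescribed up to cyclic shift because the two moves write down the merged list
  differently.\<close>

locale edge_contraction =
  fixes G H :: "'v plabic" and u v :: 'v and xs ys :: "'v list"
  assumes rs: "rotation_system G" and tree: "is_tree G"
    and uv: "u \<noteq> v" "u \<in> verts G" "v \<in> internal G"
    and bdH: "bd H = bd G" and blH: "blacks H = blacks G - {v}" and whH: "whites H = whites G - {v}"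
    and rotu: "cyc_eq (rot G u) (v # xs)" and rotv: "cyc_eq (rot G v) (u # ys)"
    and rotHu: "cyc_eq (xs @ ys) (rot H u)"
    and rotH: "\<And>x. x \<in> verts G \<Longrightarrow> x \<noteq> u \<Longrightarrow> x \<noteq> v \<Longrightarrow>
      cyc_eq (map (\<lambda>y. if y = v then u else y) (rot G x)) (rot H x)"
begin

abbreviation merge :: "'v \<Rightarrow> 'v" where
  "merge \<equiv> \<lambda>y. if y = v then u else y"

lemma v_verts: "v \<in> verts G" using uv by (simp add: verts_def)

lemma v_not_bd: "v \<notin> set (bd G)" using uv rs by (auto simp: rotation_system_def)

lemma intH: "internal H = internal G - {v}" using blH whH by (auto simp: internal_def)

lemma vertsH: "verts H = verts G - {v}" using intH bdH v_not_bd by (auto simp: verts_def)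

lemma distinct_u: "distinct (v # xs)" and distinct_v: "distinct (u # ys)"
  using rs uv v_verts cyc_eq_distinct[OF rotu] cyc_eq_distinct[OF rotv]
  unfolding rotation_system_def by blast+

lemma adj_u: "adj G u y \<longleftrightarrow> y = v \<or> y \<in> set xs" and adj_v: "adj G v y \<longleftrightarrow> y = u \<or> y \<in> set ys"
  using uv v_verts cyc_eq_set[OF rotu] cyc_eq_set[OF rotv] by (auto simp: adj_def)

lemma u_notin_xs: "u \<notin> set xs" and v_notin_ys: "v \<notin> set ys"
  using adj_neq[OF rs] adj_u adj_v by blast+

lemma bridges: "adj G x y \<Longrightarrow> y \<notin> side G x y"
  using tree acyclic_iff_bridges[OF rs] by (auto simp: is_tree_def)

text \<open>Otherwise contraction would create a double edge, which rotation lists of neighbours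
  cannot express; here the path through \<open>y\<close> would bypass the edge
  \<open>uv\<close>.\<close>

lemma no_triangle: "adj G u y \<Longrightarrow> \<not> adj G v y"
proof
  assume 1: "adj G u y" and 2: "adj G v y"
  have "y \<noteq> u" "y \<noteq> v" using 1 2 adj_neq[OF rs] by blast+
  then have "y \<in> side G u v" using side_step[OF side_refl 1] by (auto simp: doubleton_eq_iff)
  then have "v \<in> side G u v"
    using side_step[OF _ adj_sym[OF rs 2]] \<open>y \<noteq> u\<close> \<open>y \<noteq> v\<close> by (auto simp: doubleton_eq_iff)
  then show False using bridges adj_u by blast
qed

lemma xs_ys: "set xs \<inter> set ys = {}"
  using no_triangle adj_u adj_v by blast

lemma set_rotHu: "set (rot H u) = set xs \<union> set ys"
  using cyc_eq_set[OF rotHu] by simp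

lemma set_rotH: "x \<in> verts G \<Longrightarrow> x \<noteq> u \<Longrightarrow> x \<noteq> v \<Longrightarrow> set (rot H x) = merge ` set (rot G x)"
  using cyc_eq_set[OF rotH] by simp

section \<open>Edges, connectedness and bridges of the contracted graph\<close>

lemma adjH_I:
  assumes "adj G x y" "{x, y} \<noteq> {u, v}"
  shows "adj H (merge x) (merge y)"
proof -
  have V: "x \<in> verts G" "y \<in> verts G" using adj_verts[OF rs assms(1)] by auto
  consider "x = u" | "x = v" | "x \<noteq> u" "x \<noteq> v" by blast
  then show ?thesis
  proof cases
    case 1
    then have "y \<in> set xs" using adj_u assms by auto
    then show ?thesis using 1 set_rotHu uv distinct_u by (auto simp: adj_def vertsH)
  next
    case 2
    then have "y \<in> set ys" using adj_v assms by (auto simp: insert_commute)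
    then show ?thesis using 2 set_rotHu uv v_notin_ys by (auto simp: adj_def vertsH)
  next
    case 3
    then show ?thesis using set_rotH[OF V(1) 3] V assms(1) by (auto simp: adj_def vertsH)
  qed
qed

text \<open>Every edge of \<open>H\<close> has a lift, but the lift of its end \<open>u\<close>
  depends on the edge: it may be \<open>u\<close> or \<open>v\<close>.\<close>

lemma adjH_E:
  assumes "adj H x y"
  obtains x' y' where "adj G x' y'" "{x', y'} \<noteq> {u, v}" "merge x' = x" "merge y' = y"
proof -
  have V: "x \<in> verts G" "x \<noteq> v" and y: "y \<in> set (rot H x)" using assms by (auto simp: adj_def vertsH)
  show ?thesis
  proof (cases "x = u")
    case True
    then consider "y \<in> set xs" | "y \<in> set ys" using y set_rotHu by auto
    then show ?thesis
    proof cases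
      case 1
      then have "y \<noteq> u" "y \<noteq> v" using distinct_u u_notin_xs by auto
      then show ?thesis using 1 that[of u y] True adj_u uv
        by (auto simp: doubleton_eq_iff)
    next
      case 2
      then have "y \<noteq> u" "y \<noteq> v" using distinct_v v_notin_ys by auto
      then show ?thesis using 2 that[of v y] True adj_v uv
        by (auto simp: doubleton_eq_iff)
    qed
  next
    case False
    then obtain y' where "y' \<in> set (rot G x)" "merge y' = y" using y set_rotH V by auto
    then show ?thesis using that[of x y'] V False by (auto simp: adj_def doubleton_eq_iff)
  qed
qed

lemma adj_unmerge:
  assumes "adj H x y" "x \<noteq> u" "y \<noteq> u"
  shows "adj G x y"
  using adjH_E[OF assms(1)] assms(2,3) by (metis (full_types))

lemma rotation_system_H: "rotation_system H"
  unfolding rotation_system_def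
proof (intro conjI ballI allI impI)
  show "finite (verts H)" "distinct (bd H)" "blacks H \<inter> whites H = {}" "set (bd H) \<inter> internal H = {}"
    using rs by (auto simp: rotation_system_def vertsH bdH blH whH intH)
next
  fix x assume "x \<in> verts H"
  then have x: "x \<in> verts G" "x \<noteq> v" by (auto simp: vertsH)
  show "distinct (rot H x)"
  proof (cases "x = u")
    case True
    then show ?thesis using cyc_eq_distinct[OF rotHu] distinct_u distinct_v xs_ys by auto
  next
    case False
    have "inj_on merge (set (rot G x))"
    proof -
      have "\<not> (u \<in> set (rot G x) \<and> v \<in> set (rot G x))"
        using no_triangle adj_sym[OF rs] x by (metis adj_def)
      then show ?thesis by (auto simp: inj_on_def)
    qed
    moreover have "distinct (rot G x)" using rs x by (auto simp: rotation_system_def)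
    ultimately show ?thesis using cyc_eq_distinct[OF rotH] x False by (simp add: distinct_map)
  qed
next
  fix x assume x: "x \<in> verts H"
  show "set (rot H x) \<subseteq> verts H - {x}"
  proof
    fix y assume "y \<in> set (rot H x)"
    then have "adj H x y" using x by (simp add: adj_def)
    then obtain x' y' where *: "adj G x' y'" "{x', y'} \<noteq> {u, v}" "merge x' = x" "merge y' = y"
      by (rule adjH_E)
    then have "y \<in> verts H" using adj_verts[OF rs *(1)] uv *(4) by (auto simp: vertsH split: if_splits)
    moreover have "y \<noteq> x" using * adj_neq[OF rs *(1)] by (auto split: if_splits)
    ultimately show "y \<in> verts H - {x}" by simp
  qed
next
  fix x y assume "adj H x y"
  then obtain x' y' where *: "adj G x' y'" "{x', y'} \<noteq> {u, v}" "merge x' = x" "merge y' = y"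
    by (rule adjH_E)
  then show "adj H y x" using adjH_I[OF adj_sym[OF rs *(1)]] by (simp add: insert_commute)
qed

lemma connected_H: "(adj G)\<^sup>*\<^sup>* x y \<Longrightarrow> (adj H)\<^sup>*\<^sup>* (merge x) (merge y)"
proof (rule rtranclp_simulation[where I = "\<lambda>_. True" and f = merge and R = "adj G"])
  fix a b assume ab: "adj G a b"
  show "True \<and> (adj H)\<^sup>*\<^sup>* (merge a) (merge b)"
  proof (cases "{a, b} = {u, v}")
    case True
    then show ?thesis by (auto simp: doubleton_eq_iff)
  next
    case False
    show ?thesis using adjH_I[OF ab False] by blast
  qed
qed auto

text \<open>A detour around \<open>xy\<close> in \<open>H\<close> is lifted edge by edge.
  Consecutive lifts may disagree about \<open>u\<close> and \<open>v\<close>, which is harmless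
  because the edge \<open>uv\<close> lies entirely on one side of the lifted edge.\<close>

lemma bridges_H:
  assumes "adj H x y"
  shows "y \<notin> side H x y"
proof
  assume ys: "y \<in> side H x y"
  obtain x' y' where *: "adj G x' y'" "{x', y'} \<noteq> {u, v}" "merge x' = x" "merge y' = y"
    using assms by (rule adjH_E)
  have uv_step: "u \<in> side G x' y' \<longleftrightarrow> v \<in> side G x' y'"
    using side_step[of u G x' y' v] side_step[of v G x' y' u] adj_u[of v] adj_v[of u] *(2)
    by (auto simp: insert_commute)
  then have merge_side: "z \<in> side G x' y' \<longleftrightarrow> w \<in> side G x' y'" if "merge z = merge w" for z w
    using that by (auto split: if_splits)
  from ys have "\<exists>z. merge z = y \<and> z \<in> side G x' y'"
  proof (induction rule: side_induct)
    case base
    then show ?case using *(3) by (intro exI[of _ x']) simp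
  next
    case (step a b)
    from step.IH obtain z where z: "merge z = a" "z \<in> side G x' y'" by blast
    obtain a' b' where ab: "adj G a' b'" "{a', b'} \<noteq> {u, v}" "merge a' = a" "merge b' = b"
      using step.hyps(2) by (rule adjH_E)
    have "a' \<in> side G x' y'" using merge_side z ab(3) by metis
    moreover have "{a', b'} \<noteq> {x', y'}"
      using step.hyps(3) ab(3,4) *(3,4) by (auto simp: doubleton_eq_iff)
    ultimately have "b' \<in> side G x' y'" using side_step ab(1) by metis
    then show ?case using ab(4) by blast
  qed
  then have "y' \<in> side G x' y'" using merge_side *(4) by metis
  then show False using bridges *(1) by blast
qed

lemma is_tree_H: "is_tree H"
proof -
  have "(adj H)\<^sup>*\<^sup>* x y" if "x \<in> verts H" "y \<in> verts H" for x y
  proof -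
    have "(adj G)\<^sup>*\<^sup>* x y" using tree that by (auto simp: is_tree_def vertsH)
    from connected_H[OF this] that show ?thesis by (simp add: vertsH)
  qed
  moreover have "verts H \<noteq> {}" using uv by (auto simp: vertsH)
  ultimately show ?thesis
    using acyclic_iff_bridges[OF rotation_system_H] bridges_H unfolding is_tree_def by blast
qed

section \<open>Degrees and faces of the contracted graph\<close>

lemma length_rotHu: "length (rot H u) = length xs + length ys"
  using cyc_eq_length[OF rotHu] by simp

lemma deg_u: "deg G u = Suc (length xs)" and deg_v: "deg G v = Suc (length ys)"
  using cyc_eq_length[OF rotu] cyc_eq_length[OF rotv] by (auto simp: deg_def)

lemma degH: "x \<in> verts G \<Longrightarrow> x \<noteq> v \<Longrightarrow> deg H x = (if x = u then deg G u + deg G v - 2 else deg G x)"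
  using length_rotHu deg_u deg_v cyc_eq_length[OF rotH[of x]] by (auto simp: deg_def)

text \<open>The image of a dart of \<open>G\<close>; the two darts on the contracted edge have no image and are
  sent to the dart by which the face arrives at the merged vertex.\<close>

definition dart :: "'v \<times> 'v \<Rightarrow> 'v \<times> 'v" where
  "dart d = (if d = (u, v) then (last xs, u) else if d = (v, u) then (last ys, u)
     else (merge (fst d), merge (snd d)))"

text \<open>The only turns affected are those along the contracted edge. A face that runs from
  \<open>last xs\<close> over \<open>u\<close> and \<open>v\<close> to \<open>hd ys\<close> makes
  one turn in \<open>H\<close> instead of two, so entering the edge costs no step and leaving it
  costs one; the same holds from \<open>last ys\<close> to \<open>hd xs\<close>.\<close>

lemma step_dart:
  assumes "step G (a, x) (x, b)" "adj G a x" "u \<in> internal G" "xs \<noteq> []" "ys \<noteq> []"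
  shows "(step H)\<^sup>*\<^sup>* (dart (a, x)) (dart (x, b))"
proof -
  have nb: "x \<notin> set (bd G)" and cw: "cw_next (rot G x) a b" using assms(1) by auto
  have u_nb: "u \<notin> set (bd H)" using assms(3) rs by (auto simp: rotation_system_def bdH)
  have cwH: "step H (p, u) (u, q)" if "cw_next (xs @ ys) p q" for p q
    using cw_next_cyc_eq[OF rotHu] that u_nb by simp
  have "hd xs \<in> set xs" "last xs \<in> set xs" "hd ys \<in> set ys" "last ys \<in> set ys"
    using assms(4,5) by auto
  then have xs: "hd xs \<noteq> v" "last xs \<noteq> v" "hd xs \<noteq> u" "last xs \<noteq> u"
    and ys: "hd ys \<noteq> v" "last ys \<noteq> v" "hd ys \<noteq> u" "last ys \<noteq> u"
    using distinct_u u_notin_xs distinct_v v_notin_ys by auto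
  obtain xs0 where xs0: "xs = xs0 @ [last xs]" using assms(4) by (metis append_butlast_last_id)
  obtain ys0 where ys0: "ys = ys0 @ [last ys]" using assms(5) by (metis append_butlast_last_id)
  obtain xs1 where xs1: "xs = hd xs # xs1" using assms(4) by (metis list.collapse)
  obtain ys1 where ys1: "ys = hd ys # ys1" using assms(5) by (metis list.collapse)
  \<comment> \<open>The next two facts are the places where \<open>xs @ ys\<close>, read cyclically,
    passes from one list to the other.\<close>
  have mid: "cw_next (xs @ ys) (last xs) (hd ys)"
    using cw_next_append[of xs0 "last xs" "hd ys" ys1] xs0 ys1 by (metis append.assoc append_Cons append_Nil)
  have wrap: "cw_next (xs @ ys) (last ys) (hd xs)"
    using cw_next_wrap[of "hd xs" "xs1 @ ys0" "last ys"] xs1 ys0 by (metis append.assoc append_Cons)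
  consider "x = u" | "x = v" | "x \<noteq> u" "x \<noteq> v" by blast
  then show ?thesis
  proof cases
    case 1
    have "cw_next (v # xs) a b" using cw 1 cw_next_cyc_eq[OF rotu] by simp
    from this distinct_u assms(4) show ?thesis
    proof (rule cw_next_Cons_cases)
      assume "a = v" "b = hd xs"
      then show ?thesis using 1 cwH[OF wrap] uv xs by (auto simp: dart_def)
    next
      assume "a = last xs" "b = v"
      then show ?thesis using 1 uv xs by (auto simp: dart_def)
    next
      fix ps qs assume p: "xs = ps @ a # b # qs"
      then have p': "a \<noteq> u" "a \<noteq> v" "b \<noteq> u" "b \<noteq> v"
        using distinct_u u_notin_xs by auto
      from p have "cw_next (xs @ ys) a b" using cw_next_append[of ps a b "qs @ ys"] by simp
      then show ?thesis using 1 cwH[of a b] p' uv by (auto simp: dart_def)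
    qed
  next
    case 2
    have "cw_next (u # ys) a b" using cw 2 cw_next_cyc_eq[OF rotv] by simp
    from this distinct_v assms(5) show ?thesis
    proof (rule cw_next_Cons_cases)
      assume "a = u" "b = hd ys"
      then show ?thesis using 2 cwH[OF mid] uv ys by (auto simp: dart_def)
    next
      assume "a = last ys" "b = u"
      then show ?thesis using 2 uv ys by (auto simp: dart_def)
    next
      fix ps qs assume p: "ys = ps @ a # b # qs"
      then have p': "a \<noteq> u" "a \<noteq> v" "b \<noteq> u" "b \<noteq> v"
        using distinct_v v_notin_ys by auto
      from p have "cw_next (xs @ ys) a b" using cw_next_append[of "xs @ ps" a b "qs"] by simp
      then show ?thesis using 2 cwH[of a b] p' uv by (auto simp: dart_def)
    qed
  next
    case 3
    have "x \<in> verts G" using adj_verts[OF rs assms(2)] by simp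
    then have "cw_next (rot H x) (merge a) (merge b)"
      using cw_next_map[OF cw, of merge] cw_next_cyc_eq[OF rotH] 3 by metis
    then have "step H (merge a, x) (x, merge b)" using nb by (simp add: bdH)
    then show ?thesis using 3 by (auto simp: dart_def)
  qed
qed

text \<open>As neither end of the contracted edge is a leaf, the merged vertex has degree at least
  2; faces are transported by \<open>step_dart\<close>.\<close>

lemma plabic_tree_H:
  assumes "plabic_tree G" "u \<in> internal G" "xs \<noteq> []" "ys \<noteq> []"
  shows "plabic_tree H"
proof -
  have int: "x \<in> internal G \<Longrightarrow> x \<in> verts G" for x by (simp add: verts_def)
  have bdv: "x \<in> set (bd G) \<Longrightarrow> x \<in> verts G \<and> x \<noteq> u \<and> x \<noteq> v" for x
    using rs assms(2) uv by (auto simp: verts_def rotation_system_def)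
  have "length xs > 0" "length ys > 0" using assms by auto
  then have "length xs + length ys \<noteq> 1" by linarith
  then have 1: "deg H x \<noteq> 1" if "x \<in> internal H" for x
    using that assms(1) degH[of x] int deg_u deg_v by (auto simp: intH plabic_tree_def)
  have 2: "deg H x = 1" if "x \<in> set (bd H)" for x
    using that assms(1) degH[of x] bdv by (auto simp: bdH plabic_tree_def)
  have "boundary_clockwise H"
    unfolding boundary_clockwise_iff_step bdH
  proof (intro allI impI)
    fix i assume i: "i < length (bd G)"
    let ?s = "bd G ! i" and ?t = "bd G ! (Suc i mod length (bd G))"
    have st: "?s \<in> set (bd G)" "?t \<in> set (bd G)" using i by (auto intro!: nth_mem mod_less_divisor)
    obtain x y where xy: "adj G ?s x" "(step G)\<^sup>*\<^sup>* (?s, x) (y, ?t)"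
      using assms(1) i unfolding plabic_tree_def boundary_clockwise_iff_step by blast
    have "(step H)\<^sup>*\<^sup>* (dart (?s, x)) (dart (y, ?t))"
    proof (rule rtranclp_simulation[where I = "\<lambda>d. adj G (fst d) (snd d)", OF xy(2)])
      fix d e assume d: "adj G (fst d) (snd d)" "step G d e"
      then have "e = (snd d, snd e)" by (simp add: step_def prod_eq_iff)
      moreover have "adj G (snd d) (snd e)"
        using d adj_verts[OF rs d(1)] cw_next_in unfolding step_def adj_def by metis
      ultimately show "adj G (fst e) (snd e) \<and> (step H)\<^sup>*\<^sup>* (dart d) (dart e)"
        using step_dart[of "fst d" "snd d" "snd e"] d assms by (metis fst_conv snd_conv prod.collapse)
    qed (use xy in simp)
    \<comment> \<open>Boundary vertices are distinct from \<open>u\<close> and \<open>v\<close>, so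
      the face in \<open>H\<close> still starts and ends at the same labels.\<close>
    moreover have "dart (?s, x) = (?s, merge x)" "dart (y, ?t) = (merge y, ?t)"
      using bdv st by (auto simp: dart_def)
    moreover have "adj H ?s (merge x)"
      using adjH_I[OF xy(1)] bdv[OF st(1)] by (auto simp: doubleton_eq_iff)
    ultimately show "\<exists>x y. adj H ?s x \<and> (step H)\<^sup>*\<^sup>* (?s, x) (y, ?t)" by auto
  qed
  then show ?thesis
    using 1 2 rotation_system_H is_tree_H by (simp add: plabic_tree_def)
qed

end

subsection \<open>Moves are edge contractions\<close>

lemma cyc_eq_Cons_ex: "x \<in> set xs \<Longrightarrow> \<exists>ys. cyc_eq xs (x # ys)"
  by (metis split_list cyc_eq_append append_Cons)

lemma plabic_treeD:
  assumes "plabic_tree G"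
  shows "rotation_system G" "is_tree G" "finite (blacks G)"
  using assms by (auto simp: plabic_tree_def rotation_system_def verts_def internal_def)

lemma edge_contraction_contract:
  assumes "plabic_tree G" "u \<in> internal G" "v \<in> internal G"
    "cyc_eq (rot G u) (v # xs)" "cyc_eq (rot G v) (u # ys)"
    "H = \<lparr>bd = bd G, blacks = blacks G - {v}, whites = whites G - {v},
          rot = (\<lambda>x. if x = u then xs @ ys else map (\<lambda>y. if y = v then u else y) (rot G x))\<rparr>"
  shows "edge_contraction G H u v xs ys"
proof -
  have "u \<in> verts G" using assms(2) by (simp add: verts_def)
  moreover have "v \<in> set (rot G u)" using cyc_eq_set[OF assms(4)] by auto
  ultimately have "u \<noteq> v" using plabic_treeD(1)[OF assms(1)] by (auto simp: rotation_system_def)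
  then show ?thesis
    using plabic_treeD[OF assms(1)] assms(2-5) \<open>u \<in> verts G\<close>
    by unfold_locales (auto simp: assms(6))
qed

lemma contraction_edge_contraction:
  assumes "plabic_tree G" "contraction G H"
  obtains u v xs ys where "edge_contraction G H u v xs ys"
    "{u, v} \<subseteq> blacks G \<or> {u, v} \<subseteq> whites G"
proof -
  from assms(2) obtain u v xs ys where *: "{u, v} \<subseteq> blacks G \<or> {u, v} \<subseteq> whites G"
    "cyc_eq (rot G u) (v # xs)" "cyc_eq (rot G v) (u # ys)"
    and H: "H = \<lparr>bd = bd G, blacks = blacks G - {v}, whites = whites G - {v},
          rot = (\<lambda>x. if x = u then xs @ ys else map (\<lambda>y. if y = v then u else y) (rot G x))\<rparr>"
    unfolding contraction_def by blast
  have "u \<in> internal G" "v \<in> internal G" using *(1) by (auto simp: internal_def)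
  from edge_contraction_contract[OF assms(1) this *(2,3) H] *(1) show ?thesis using that by blast
qed

text \<open>Removing \<open>v\<close> from the path \<open>a v b\<close> is contracting the edge
  \<open>av\<close>: the merged vertex is \<open>a\<close>, and the rest of the rotation at
  \<open>v\<close> is \<open>[b]\<close>.\<close>

lemma deg2_edge_contraction:
  assumes "plabic_tree G" "v \<in> internal G" "rot G v = [a, b]"
    "H = \<lparr>bd = bd G, blacks = blacks G - {v}, whites = whites G - {v},
          rot = (\<lambda>x. if x = a then map (\<lambda>y. if y = v then b else y) (rot G a)
                     else if x = b then map (\<lambda>y. if y = v then a else y) (rot G b)
                     else rot G x)\<rparr>"
  obtains xs where "edge_contraction G H a v xs [b]"
proof -
  note rs = plabic_treeD(1)[OF assms(1)]
  have v: "v \<in> verts G" using assms(2) by (simp add: verts_def)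
  have adjv: "adj G v y \<longleftrightarrow> y = a \<or> y = b" for y using v assms(3) by (auto simp: adj_def)
  have nbrs: "x \<noteq> a \<Longrightarrow> x \<noteq> b \<Longrightarrow> x \<in> verts G \<Longrightarrow> v \<notin> set (rot G x)" for x
    using adj_sym[OF rs] adjv by (metis adj_def)
  have a: "a \<in> verts G" "a \<noteq> v"
    using adj_verts[OF rs, of v a] adj_neq[OF rs, of v a] adjv by blast+
  have "v \<in> set (rot G a)" using adj_sym[OF rs] adjv by (metis adj_def)
  then obtain xs where xs: "cyc_eq (rot G a) (v # xs)" using cyc_eq_Cons_ex by metis
  have "distinct (v # xs)" using cyc_eq_distinct[OF xs] rs a by (auto simp: rotation_system_def)
  then have "map (\<lambda>y. if y = v then b else y) (v # xs) = b # xs"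
    by (auto intro: map_idI)
  then have "cyc_eq (map (\<lambda>y. if y = v then b else y) (rot G a)) (b # xs)"
    using cyc_eq_map[OF xs, of "\<lambda>y. if y = v then b else y"] by simp
  \<comment> \<open>Replacing \<open>v\<close> by \<open>b\<close> in place gives
    \<open>b # xs\<close>, a cyclic shift of the list \<open>xs @ [b]\<close> that contraction
    prescribes.\<close>
  then have "cyc_eq (xs @ [b]) (map (\<lambda>y. if y = v then b else y) (rot G a))"
    using cyc_eq_trans[OF cyc_eq_append[of xs "[b]"] cyc_eq_sym] by simp
  moreover have "cyc_eq (map (\<lambda>y. if y = v then a else y) (rot G x)) (rot H x)"
    if "x \<in> verts G" "x \<noteq> a" "x \<noteq> v" for x
  proof (cases "x = b")
    case True
    then show ?thesis using that by (simp add: assms(4))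
  next
    case False
    then have "map (\<lambda>y. if y = v then a else y) (rot G x) = rot G x"
      using nbrs[of x] that by (intro map_idI) auto
    then show ?thesis using that False by (simp add: assms(4))
  qed
  ultimately have "edge_contraction G H a v xs [b]"
    using plabic_treeD[OF assms(1)] a assms(2,3) xs
    by unfold_locales (auto simp: assms(4))
  then show ?thesis using that by blast
qed

subsection \<open>An invariant of moves\<close>

text \<open>This is \<open>k - 1\<close> for a graph of type \<open>(k, n)\<close>. Merging two
  black vertices adds up their terms, and a vertex of degree 2 contributes 0.\<close>

definition excess :: "'v plabic \<Rightarrow> int" where
  "excess G = (\<Sum>b\<in>blacks G. int (deg G b) - 2)"

text \<open>For excess 1 and nonempty boundary this is the one trivalent black vertex. A description
  by degree survives when a contraction merges that vertex under another name.\<close>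

definition branching :: "'v plabic \<Rightarrow> 'v set" where
  "branching G = {b \<in> blacks G. 3 \<le> deg G b}"

definition linked :: "'v plabic \<Rightarrow> 'v \<Rightarrow> 'v \<Rightarrow> bool" where
  "linked G = (\<lambda>x y. adj G x y \<and> x \<notin> branching G \<and> y \<notin> branching G)\<^sup>*\<^sup>*"

text \<open>Recorded by positions in \<open>bd\<close> so that trees with different vertex names can
  be compared.\<close>

definition links :: "'v plabic \<Rightarrow> (nat \<times> nat) set" where
  "links G = {(i, j). i < length (bd G) \<and> j < length (bd G) \<and> linked G (bd G ! i) (bd G ! j)}"

lemma linked_refl [simp]: "linked G x x"
  by (simp add: linked_def)

lemma linked_step:
  "linked G x y \<Longrightarrow> adj G y z \<Longrightarrow> y \<notin> branching G \<Longrightarrow> z \<notin> branching G \<Longrightarrow> linked G x z"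
  unfolding linked_def by (auto intro: rtranclp.rtrancl_into_rtrancl)

lemma linked_induct [consumes 1, case_names base step]:
  assumes "linked G x y" "P x"
    "\<And>y z. linked G x y \<Longrightarrow> P y \<Longrightarrow> adj G y z \<Longrightarrow> y \<notin> branching G \<Longrightarrow> z \<notin> branching G \<Longrightarrow> P z"
  shows "P y"
  using assms(1) unfolding linked_def
proof (induction rule: rtranclp_induct)
  case base
  show ?case by (rule assms(2))
next
  case (step y z)
  then show ?case using assms(3)[of y z] by (simp add: linked_def)
qed

lemma linked_trans: "linked G x y \<Longrightarrow> linked G y z \<Longrightarrow> linked G x z"
  unfolding linked_def by (rule rtranclp_trans)

lemma linked_sym:
  assumes "rotation_system G" "linked G x y"
  shows "linked G y x"
  using assms(2)
proof (induction rule: linked_induct)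
  case (step y z)
  then have "linked G z y" using linked_step[of G z z y] adj_sym[OF assms(1)] by auto
  then show ?case using step.IH linked_trans by metis
qed simp

text \<open>Degree 1 is excluded by leaflessness and degree 0 by connectedness to a boundary
  vertex.\<close>

lemma deg_internal:
  assumes "plabic_tree G" "bd G \<noteq> []" "x \<in> internal G"
  shows "2 \<le> deg G x"
proof -
  have "bd G ! 0 \<in> set (bd G)" using assms(2) by simp
  moreover have "set (bd G) \<inter> internal G = {}"
    using plabic_treeD(1)[OF assms(1)] by (simp add: rotation_system_def)
  ultimately have "bd G ! 0 \<in> verts G" "bd G ! 0 \<noteq> x"
    using assms(3) unfolding verts_def by blast+
  moreover have "(adj G)\<^sup>*\<^sup>* x (bd G ! 0)"
    using plabic_treeD(2)[OF assms(1)] assms(3) calculation by (auto simp: is_tree_def verts_def)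
  ultimately obtain z where "adj G x z" by (metis converse_rtranclpE)
  then have "deg G x \<noteq> 0" by (auto simp: adj_def deg_def)
  moreover have "deg G x \<noteq> 1" using assms by (simp add: plabic_tree_def)
  ultimately show ?thesis by linarith
qed

text \<open>By \<open>deg_internal\<close> all terms of the sum are nonnegative integers, so a sum
  of 1 has a single nonzero term, equal to 1.\<close>

lemma excess_1:
  assumes "plabic_tree G" "bd G \<noteq> []" "excess G = 1"
  obtains b where "b \<in> blacks G" "deg G b = 3" "branching G = {b}"
    "\<And>x. x \<in> blacks G \<Longrightarrow> x \<noteq> b \<Longrightarrow> deg G x = 2"
proof -
  note fin = plabic_treeD(3)[OF assms(1)]
  have ge: "2 \<le> deg G x" if "x \<in> blacks G" for x
    using deg_internal[OF assms(1,2)] that by (simp add: internal_def)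
  have "\<exists>b\<in>blacks G. deg G b \<noteq> 2"
  proof (rule ccontr)
    assume "\<not> ?thesis"
    then have "excess G = 0" by (simp add: excess_def)
    then show False using assms(3) by simp
  qed
  then obtain b where b: "b \<in> blacks G" "deg G b \<noteq> 2" by blast
  have s: "excess G = (int (deg G b) - 2) + (\<Sum>x\<in>blacks G - {b}. int (deg G x) - 2)"
    unfolding excess_def using fin b(1) by (simp add: sum.remove)
  have nn: "x \<in> blacks G - {b} \<Longrightarrow> 0 \<le> int (deg G x) - 2" for x using ge[of x] by auto
  then have "0 \<le> (\<Sum>x\<in>blacks G - {b}. int (deg G x) - 2)" by (rule sum_nonneg)
  then have d: "deg G b = 3" and z: "(\<Sum>x\<in>blacks G - {b}. int (deg G x) - 2) = 0"
    using s ge[OF b(1)] b(2) assms(3) by auto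
  have "\<forall>x\<in>blacks G - {b}. int (deg G x) - 2 = 0"
    using z sum_nonneg_eq_0_iff[of "blacks G - {b}" "\<lambda>x. int (deg G x) - 2"] fin nn by auto
  then have 2: "deg G x = 2" if "x \<in> blacks G" "x \<noteq> b" for x using that by auto
  then have "branching G = {b}" using b d by (fastforce simp: branching_def)
  then show ?thesis using that b d 2 by blast
qed

section \<open>Invariance under contraction of an edge\<close>

context edge_contraction
begin

text \<open>The merged vertex has degree \<open>deg G u + deg G v - 2\<close>, so the term of
  \<open>v\<close> is passed on to \<open>u\<close>. If both are black the sum is unchanged, if both
  are white neither is counted, and if \<open>deg G v = 2\<close> the term is 0.\<close>

lemma excess_H:
  assumes "({u, v} \<subseteq> blacks G \<or> {u, v} \<subseteq> whites G) \<or> deg G v = 2"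
  shows "excess H = excess G"
proof -
  have fin: "finite (blacks G)"
    using rs by (auto simp: rotation_system_def verts_def internal_def)
  have "excess H = (\<Sum>b\<in>blacks H. (int (deg G b) - 2) + (if b = u then int (deg G v) - 2 else 0))"
    unfolding excess_def
  proof (rule sum.cong)
    fix x assume "x \<in> blacks H"
    then have "x \<in> verts G" "x \<noteq> v" by (auto simp: blH verts_def internal_def)
    then show "int (deg H x) - 2 = (int (deg G x) - 2) + (if x = u then int (deg G v) - 2 else 0)"
      using deg_u deg_v by (auto simp: degH)
  qed simp
  also have "\<dots> = (\<Sum>b\<in>blacks G - {v}. int (deg G b) - 2) + (if u \<in> blacks G then int (deg G v) - 2 else 0)"
    using fin uv by (simp add: blH sum.distrib sum.delta)
  also have "\<dots> = excess G"
  proof (cases "v \<in> blacks G")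
    case True
    then have "u \<in> blacks G \<or> deg G v = 2"
      using assms rs by (auto simp: rotation_system_def)
    then show ?thesis using True fin by (auto simp: excess_def sum.remove)
  next
    case False
    then have "u \<notin> blacks G \<or> deg G v = 2"
      using assms rs by (auto simp: rotation_system_def)
    then show ?thesis using False by (auto simp: excess_def)
  qed
  finally show ?thesis .
qed

lemma branching_H: "x \<in> verts G \<Longrightarrow> x \<noteq> u \<Longrightarrow> x \<noteq> v \<Longrightarrow> x \<in> branching H \<longleftrightarrow> x \<in> branching G"
  by (auto simp: branching_def blH degH)

text \<open>Here \<open>u\<close> and \<open>v\<close> are linked by their edge, so a path in
  \<open>H\<close> lifts with free choice between the two, and a path in \<open>G\<close> loses at
  most its passages along that edge.\<close>

lemma linked_iff_no_branching:
  assumes nb: "u \<notin> branching G" "v \<notin> branching G" "u \<notin> branching H"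
    and s: "s \<noteq> v" and t: "t \<noteq> v"
  shows "linked H s t \<longleftrightarrow> linked G s t"
proof -
  have mb: "merge x \<in> branching H \<longleftrightarrow> x \<in> branching G" if "x \<in> verts G" for x
    using nb branching_H that by auto
  have "linked H (merge s) (merge t)" if "linked G s t"
    using that
  proof (induction rule: linked_induct)
    case (step y z)
    show ?case
    proof (cases "{y, z} = {u, v}")
      case True
      then have "merge y = merge z" by (auto simp: doubleton_eq_iff)
      then show ?thesis using step.IH by argo
    next
      case False
      have "merge y \<notin> branching H" "merge z \<notin> branching H"
        using mb adj_verts[OF rs step.hyps(2)] step.hyps(3,4) by blast+
      with step.IH adjH_I[OF step.hyps(2) False] show ?thesis by (rule linked_step)
    qed
  qed simp
  moreover have "linked G s t" if "linked H s t"
  proof -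
    have close: "linked G s y" if "linked G s x" "merge x = merge y" for x y
      using that linked_step[of G s u v] linked_step[of G s v u] nb(1,2) adj_u[of v] adj_v[of u]
      by (auto split: if_splits)
    from that have "\<exists>x. merge x = t \<and> linked G s x"
    proof (induction rule: linked_induct)
      case base
      then show ?case using s by (intro exI[of _ s]) simp
    next
      case (step y z)
      then obtain x where x: "merge x = y" "linked G s x" by blast
      from step.hyps(2) obtain y' z' where
        yz: "adj G y' z'" "{y', z'} \<noteq> {u, v}" "merge y' = y" "merge z' = z"
        by (rule adjH_E)
      have "merge x = merge y'" using x(1) yz(3) by argo
      from close[OF x(2) this] have "linked G s y'" .
      moreover note yz(1)
      moreover have "y' \<notin> branching G" "z' \<notin> branching G"
        using step.hyps(3,4) mb adj_verts[OF rs yz(1)] unfolding yz(3,4)[symmetric] by blast+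
      ultimately have "linked G s z'" by (rule linked_step)
      then show ?case using yz(4) by blast
    qed
    then obtain x where x: "merge x = t" "linked G s x" by blast
    then show ?thesis using close[of x t] t by simp
  qed
  ultimately show ?thesis using s t by auto
qed

text \<open>A path that avoids \<open>p\<close> and enters its neighbour \<open>q\<close> of degree 2 can only turn back there.\<close>

lemma linked_iff_branching:
  assumes pq: "{p, q} = {u, v}" and p: "p \<in> branching G" and q: "q \<notin> branching G" "deg G q = 2"
    and u: "u \<in> branching H" and s: "s \<noteq> u" "s \<noteq> v" and t: "t \<noteq> u" "t \<noteq> v"
  shows "linked H s t \<longleftrightarrow> linked G s t"
proof
  assume "linked H s t"
  then show "linked G s t"
  proof (induction rule: linked_induct)
    case (step y z)
    then have "y \<noteq> u" "z \<noteq> u" using u by auto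
    then have a: "adj G y z" using adj_unmerge step.hyps by blast
    have "y \<noteq> v" "z \<noteq> v" using adj_verts[OF rotation_system_H step.hyps(2)] by (auto simp: vertsH)
    then have "y \<notin> branching G" "z \<notin> branching G"
      using branching_H adj_verts[OF rs a] \<open>y \<noteq> u\<close> \<open>z \<noteq> u\<close> step.hyps by auto
    then show ?case using linked_step step.IH a by metis
  qed simp
next
  have pq': "p \<noteq> q" "adj G q p" using pq uv adj_u[of v] adj_v[of u] by (auto simp: doubleton_eq_iff)
  have nbr: "w = y" if "adj G q y" "y \<noteq> p" "adj G q w" "w \<noteq> p" for w y
  proof (rule ccontr)
    assume "w \<noteq> y"
    then have "card {p, y, w} = 3" using that by auto
    moreover have "{p, y, w} \<subseteq> set (rot G q)" using that pq' by (auto simp: adj_def)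
    ultimately have "3 \<le> card (set (rot G q))" by (metis List.finite_set card_mono)
    then show False using q(2) card_length[of "rot G q"] by (simp add: deg_def)
  qed
  assume "linked G s t"
  \<comment> \<open>In \<open>H\<close> the vertex \<open>q\<close> is absorbed into the branching
    vertex and cannot be visited. While the path in \<open>G\<close> is at \<open>q\<close>, the
    neighbour it came from is remembered; that is also where it goes next.\<close>
  then have "(t \<noteq> q \<longrightarrow> linked H s t) \<and> (t = q \<longrightarrow> (\<exists>y. adj G q y \<and> y \<noteq> p \<and> linked H s y))"
  proof (induction rule: linked_induct)
    case base
    then show ?case using s pq by auto
  next
    case (step y z)
    have yz: "y \<noteq> p" "z \<noteq> p" "y \<noteq> z" using step.hyps p adj_neq[OF rs] by auto
    consider "y = q" | "z = q" "y \<noteq> q" | "y \<noteq> q" "z \<noteq> q" by blast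
    then show ?case
    proof cases
      case 1
      then show ?thesis using step nbr yz by blast
    next
      case 2
      then show ?thesis using step yz adj_sym[OF rs] by blast
    next
      case 3
      then have n: "y \<noteq> u" "y \<noteq> v" "z \<noteq> u" "z \<noteq> v" using yz pq by (auto simp: doubleton_eq_iff)
      then have "adj H y z" using adjH_I[OF step.hyps(2)] by (auto simp: doubleton_eq_iff)
      moreover have "y \<notin> branching H" "z \<notin> branching H"
        using n branching_H adj_verts[OF rs step.hyps(2)] step.hyps by auto
      ultimately show ?thesis using step.IH 3 linked_step by metis
    qed
  qed
  then show "linked H s t" using t pq by (auto simp: doubleton_eq_iff)
qed

text \<open>If the trivalent vertex \<open>b\<close> is an end of the edge, the other end has degree
  2 and the merged vertex is trivalent again. If it is not, a merged black vertex has degree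
  \<open>2 + 2 - 2\<close>, so no new branching arises.\<close>

lemma links_H:
  assumes "plabic_tree G" "bd G \<noteq> []" "excess G = 1"
    and E: "({u, v} \<subseteq> blacks G \<or> {u, v} \<subseteq> whites G) \<or> deg G v = 2"
  shows "links H = links G"
proof -
  obtain b where b: "b \<in> blacks G" "deg G b = 3" "branching G = {b}"
    "\<And>x. x \<in> blacks G \<Longrightarrow> x \<noteq> b \<Longrightarrow> deg G x = 2"
    using excess_1[OF assms(1-3)] by blast
  have bw: "b \<notin> whites G" using b(1) rs by (auto simp: rotation_system_def)
  have int: "x \<in> set (bd G) \<Longrightarrow> x \<noteq> u \<or> u \<notin> internal G" for x using rs by (auto simp: rotation_system_def)
  have "linked H s t \<longleftrightarrow> linked G s t" if "s \<in> set (bd G)" "t \<in> set (bd G)" for s t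
  proof -
    have v: "s \<noteq> v" "t \<noteq> v" using that v_not_bd by auto
    consider "b = u" | "b = v" | "b \<noteq> u" "b \<noteq> v" by blast
    then show ?thesis
    proof cases
      case 1
      then have "deg G v = 2" using E b(4)[of v] bw uv(1) by auto
      moreover have "u \<in> branching H" using 1 b(1,2) \<open>deg G v = 2\<close> uv degH[of u] by (simp add: branching_def blH)
      moreover have "s \<noteq> u" "t \<noteq> u" using 1 b(1) int that by (auto simp: internal_def)
      ultimately show ?thesis using linked_iff_branching[of u v s t] 1 b(3) uv(1) v by simp
    next
      case 2
      then have ub: "u \<in> blacks G" "deg G u = 2" using E b bw uv(1) by auto
      then have "u \<in> branching H" using 2 b(1,2) uv degH[of u] by (simp add: branching_def blH)
      moreover have "s \<noteq> u" "t \<noteq> u" using ub int that by (auto simp: internal_def)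
      ultimately show ?thesis using linked_iff_branching[of v u s t] ub 2 b(3) uv(1) v by (simp add: insert_commute)
    next
      case 3
      then have "u \<in> blacks G \<Longrightarrow> deg G u = 2 \<and> deg G v = 2" using E b(4) rs by (auto simp: rotation_system_def)
      then have "u \<notin> branching H" using degH[of u] uv by (auto simp: branching_def blH)
      then show ?thesis using linked_iff_no_branching[of s t] 3 b(3) v by simp
    qed
  qed
  then show ?thesis by (auto simp: links_def bdH)
qed

end

lemma isotopic_invariants:
  assumes "plabic_tree G" "plabic_tree H" "isotopic G H"
  shows "length (bd H) = length (bd G)" "excess H = excess G" "links H = links G"
proof -
  from assms(3) obtain f where f: "bij_betw f (verts G) (verts H)" "map f (bd G) = bd H"
    "f ` blacks G = blacks H" "f ` whites G = whites H"
    "\<And>v. v \<in> verts G \<Longrightarrow> cyc_eq (map f (rot G v)) (rot H (f v))"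
    by (auto simp: isotopic_def)
  note rsG = plabic_treeD(1)[OF assms(1)] and rsH = plabic_treeD(1)[OF assms(2)]
  have inj: "inj_on f (verts G)" using f(1) by (simp add: bij_betw_def)
  have fv: "f x \<in> verts H" if "x \<in> verts G" for x using that f(1) by (auto simp: bij_betw_def)
  have bv: "blacks G \<subseteq> verts G" "set (bd G) \<subseteq> verts G" by (auto simp: verts_def internal_def)
  have d: "deg H (f x) = deg G x" if "x \<in> verts G" for x
    using cyc_eq_length[OF f(5)[OF that]] by (simp add: deg_def)
  have adjHf: "adj H (f x) z \<longleftrightarrow> (\<exists>y. z = f y \<and> adj G x y)" if "x \<in> verts G" for x z
    using cyc_eq_set[OF f(5)[OF that]] that fv by (auto simp: adj_def)
  show l: "length (bd H) = length (bd G)" using f(2) by (metis length_map)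
  show "excess H = excess G"
    unfolding excess_def f(3)[symmetric]
    using bv(1) d by (subst sum.reindex[OF inj_on_subset[OF inj bv(1)]]) (auto intro!: sum.cong)
  have br: "f x \<in> branching H \<longleftrightarrow> x \<in> branching G" if "x \<in> verts G" for x
    using that d inj bv unfolding branching_def f(3)[symmetric] by (auto simp: inj_on_def)
  have "linked H (f s) (f t) \<longleftrightarrow> linked G s t" if st: "s \<in> verts G" "t \<in> verts G" for s t
  proof
    assume "linked G s t"
    then show "linked H (f s) (f t)"
    proof (induction rule: linked_induct)
      case (step y z)
      have "y \<in> verts G" "z \<in> verts G" using adj_verts[OF rsG step.hyps(2)] by auto
      then show ?case using step br adjHf linked_step by metis
    qed simp
  next
    assume "linked H (f s) (f t)"
    then have "\<exists>y\<in>verts G. f t = f y \<and> linked G s y"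
    proof (induction rule: linked_induct)
      case base
      then show ?case using st by auto
    next
      case (step y z)
      then obtain x where x: "x \<in> verts G" "y = f x" "linked G s x" by blast
      then obtain w where w: "z = f w" "adj G x w" using step.hyps(2) adjHf by auto
      have "w \<in> verts G" using adj_verts[OF rsG w(2)] by simp
      then show ?case using x w step.hyps br linked_step by metis
    qed
    then show "linked G s t" using inj st by (auto simp: inj_on_def)
  qed
  moreover have "bd H ! i = f (bd G ! i)" "bd G ! i \<in> verts G" if "i < length (bd G)" for i
    using that bv(2) nth_mem[OF that] by (auto simp: f(2)[symmetric])
  ultimately show "links H = links G" by (auto simp: links_def l)
qed

text \<open>Invariance of \<open>links\<close> is available at excess 1 with nonempty boundary;
  length and excess are carried along so that this condition passes from tree to tree.\<close>

lemma move_equiv_invariants: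
  fixes G H :: "'a plabic"
  assumes "move_equiv G H"
  shows "length (bd H) = length (bd G)" "excess H = excess G"
    "bd G \<noteq> [] \<Longrightarrow> excess G = 1 \<Longrightarrow> links H = links G"
proof -
  define inv :: "'a plabic \<Rightarrow> 'a plabic \<Rightarrow> bool" where
    "inv K L \<longleftrightarrow> length (bd L) = length (bd K) \<and> excess L = excess K \<and>
      (bd K \<noteq> [] \<longrightarrow> excess K = 1 \<longrightarrow> links L = links K)" for K L
  have one: "inv G H" if pl: "plabic_tree G" "plabic_tree H"
    "isotopic G H \<or> contraction G H \<or> deg2_removal G H" for G H
    using pl(3)
  proof (elim disjE)
    assume "isotopic G H"
    then show ?thesis using isotopic_invariants pl unfolding inv_def by blast
  next
    assume "contraction G H"
    then obtain u v xs ys where e: "edge_contraction G H u v xs ys"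
      "{u, v} \<subseteq> blacks G \<or> {u, v} \<subseteq> whites G"
      using contraction_edge_contraction[OF pl(1)] by blast
    interpret edge_contraction G H u v xs ys by (rule e(1))
    show ?thesis using e(2) excess_H links_H[OF pl(1)] unfolding inv_def bdH by blast
  next
    assume "deg2_removal G H"
    then obtain v a b where v: "v \<in> internal G" "rot G v = [a, b]" and
      H: "H = \<lparr>bd = bd G, blacks = blacks G - {v}, whites = whites G - {v},
          rot = (\<lambda>x. if x = a then map (\<lambda>y. if y = v then b else y) (rot G a)
                     else if x = b then map (\<lambda>y. if y = v then a else y) (rot G b)
                     else rot G x)\<rparr>" unfolding deg2_removal_def by blast
    obtain xs where e: "edge_contraction G H a v xs [b]"
      using deg2_edge_contraction[OF pl(1) v H] by blast
    interpret edge_contraction G H a v xs "[b]" by (rule e)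
    have "deg G v = 2" by (simp add: v(2) deg_def)
    then show ?thesis using excess_H links_H[OF pl(1)] unfolding inv_def bdH by blast
  qed
  have "inv G H"
    using assms unfolding move_equiv_def
  proof (induction rule: equivclp_induct)
    case base
    then show ?case by (simp add: inv_def)
  next
    case (step y z)
    then have "inv y z \<or> inv z y" using one by blast
    \<comment> \<open>A move may be applied backwards; the condition inside \<open>inv\<close>
      transfers because length and excess agree.\<close>
    then have "inv y z" unfolding inv_def by (metis length_0_conv)
    then show ?case using step.IH unfolding inv_def by (metis length_0_conv)
  qed
  then show "length (bd H) = length (bd G)" "excess H = excess G"
    "bd G \<noteq> [] \<Longrightarrow> excess G = 1 \<Longrightarrow> links H = links G"
    by (auto simp: inv_def)
qed

subsection \<open>Removing the black vertices of degree 2\<close>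

lemma move_equiv_refl [simp]: "move_equiv G G"
  by (simp add: move_equiv_def)

lemma move_equiv_sym: "move_equiv G H \<Longrightarrow> move_equiv H G"
  unfolding move_equiv_def by (rule equivclp_sym)

lemma move_equiv_trans: "move_equiv G H \<Longrightarrow> move_equiv H K \<Longrightarrow> move_equiv G K"
  unfolding move_equiv_def by (rule equivclp_trans)

lemma move_equivI:
  "plabic_tree G \<Longrightarrow> plabic_tree H \<Longrightarrow> isotopic G H \<or> contraction G H \<or> deg2_removal G H \<Longrightarrow>
    move_equiv G H"
  unfolding move_equiv_def by (rule r_into_equivclp) simp

text \<open>Removal of \<open>v\<close> makes its neighbours \<open>a\<close> and \<open>b\<close>
  adjacent although both are white; contracting the edge between them restores bipartiteness. Both
  are internal because boundary vertices count as black.\<close>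

lemma remove_black_deg2:
  fixes G :: "'a plabic"
  assumes G: "plabic_tree G" "bipartite G" "bd G \<noteq> []" and v: "v \<in> blacks G" "deg G v = 2"
  obtains K where "plabic_tree K" "bipartite K" "move_equiv G K" "card (blacks K) < card (blacks G)"
proof -
  note rs = plabic_treeD(1)[OF G(1)]
  obtain a b where ab: "rot G v = [a, b]" using v(2) by (auto simp: deg_def length_Suc_conv numeral_2_eq_2)
  have vi: "v \<in> internal G" "v \<in> verts G" using v by (auto simp: internal_def verts_def)
  have adjv: "adj G v y \<longleftrightarrow> y = a \<or> y = b" for y using vi ab by (auto simp: adj_def)
  have w: "y \<in> whites G \<and> y \<notin> set (bd G) \<union> blacks G" if "adj G v y" for y
  proof -
    have "y \<notin> set (bd G) \<union> blacks G" using G(2) that v(1) unfolding bipartite_def by blast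
    then show ?thesis using adj_verts[OF rs that] by (auto simp: verts_def internal_def)
  qed
  then have wab: "a \<in> whites G" "b \<in> whites G" "a \<notin> set (bd G) \<union> blacks G" "b \<notin> set (bd G) \<union> blacks G"
    using adjv by auto
  have ne: "a \<noteq> b" "a \<noteq> v" "b \<noteq> v" using rs vi ab adj_neq[OF rs] adjv by (auto simp: rotation_system_def)
  define H where "H = \<lparr>bd = bd G, blacks = blacks G - {v}, whites = whites G - {v},
          rot = (\<lambda>x. if x = a then map (\<lambda>y. if y = v then b else y) (rot G a)
                     else if x = b then map (\<lambda>y. if y = v then a else y) (rot G b)
                     else rot G x)\<rparr>"
  obtain xs where "edge_contraction G H a v xs [b]"
    using deg2_edge_contraction[OF G(1) vi(1) ab H_def] by blast
  then interpret E: edge_contraction G H a v xs "[b]" .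
  have ai: "a \<in> internal G" "b \<in> internal G" using wab by (auto simp: internal_def)
  have "2 \<le> deg G a" by (rule deg_internal[OF G(1,3) ai(1)])
  then have "xs \<noteq> []" using E.deg_u by auto
  then have pH: "plabic_tree H" using E.plabic_tree_H[OF G(1) ai(1)] by simp
  have bdH: "bd H \<noteq> []" using G(3) by (simp add: E.bdH)
  have mH: "move_equiv G H"
    by (rule move_equivI[OF G(1) pH]) (use vi(1) ab H_def in \<open>unfold deg2_removal_def, blast\<close>)
  have "adj H a b" using E.adjH_I[of v b] adjv ne by (auto simp: doubleton_eq_iff)
  moreover have "adj H b a" by (rule adj_sym[OF E.rotation_system_H calculation])
  ultimately have "b \<in> set (rot H a)" "a \<in> set (rot H b)" by (auto simp: adj_def)
  then obtain xs' ys' where r: "cyc_eq (rot H a) (b # xs')" "cyc_eq (rot H b) (a # ys')"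
    using cyc_eq_Cons_ex by metis
  define K where "K = \<lparr>bd = bd H, blacks = blacks H - {b}, whites = whites H - {b},
          rot = (\<lambda>x. if x = a then xs' @ ys' else map (\<lambda>y. if y = b then a else y) (rot H x))\<rparr>"
  have aiH: "a \<in> internal H" "b \<in> internal H" using ai ne by (auto simp: E.intH)
  interpret F: edge_contraction H K a b xs' ys'
    by (rule edge_contraction_contract[OF pH aiH r K_def])
  have "2 \<le> deg H a" "2 \<le> deg H b" by (rule deg_internal[OF pH bdH]; fact aiH)+
  then have "xs' \<noteq> []" "ys' \<noteq> []" using F.deg_u F.deg_v by auto
  then have pK: "plabic_tree K" using F.plabic_tree_H[OF pH aiH(1)] by simp
  have wH: "{a, b} \<subseteq> whites H" using wab ne by (auto simp: E.whH)
  have mK: "move_equiv H K"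
    by (rule move_equivI[OF pH pK]) (use wH r K_def in \<open>unfold contraction_def, blast\<close>)
  have bip: "bipartite K"
    unfolding bipartite_def
  proof (intro allI impI)
    fix x y assume "adj K x y"
    then obtain x' y' where 1: "adj H x' y'" "{x', y'} \<noteq> {a, b}" "F.merge x' = x" "F.merge y' = y"
      by (rule F.adjH_E)
    from 1(1) obtain x'' y'' where 2: "adj G x'' y''" "{x'', y''} \<noteq> {a, v}"
      "E.merge x'' = x'" "E.merge y'' = y'" by (rule E.adjH_E)
    \<comment> \<open>The edges at \<open>v\<close> do not survive: \<open>av\<close> is contracted
      first, and \<open>vb\<close> turns into \<open>ab\<close>, which is contracted next.\<close>
    have "x'' \<noteq> v"
    proof
      assume "x'' = v"
      then have "y'' = b" using 2(1,2) adjv by (auto simp: doubleton_eq_iff)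
      then show False using 1(2) 2(3,4) \<open>x'' = v\<close> ne by auto
    qed
    moreover have "y'' \<noteq> v"
    proof
      assume "y'' = v"
      then have "x'' = b" using 2(1,2) adj_sym[OF rs] adjv by (auto simp: doubleton_eq_iff)
      then show False using 1(2) 2(3,4) \<open>y'' = v\<close> ne by auto
    qed
    ultimately have *: "adj G x' y'" "x' \<noteq> v" "y' \<noteq> v" using 2 by auto
    have "z \<in> set (bd K) \<union> blacks K \<longleftrightarrow> z' \<in> set (bd G) \<union> blacks G" if "F.merge z' = z" "z' \<noteq> v" for z z'
      using that wab ne by (auto simp: F.bdH F.blH E.bdH E.blH split: if_splits)
    from this[OF 1(3) *(2)] this[OF 1(4) *(3)]
    show "(x \<in> set (bd K) \<union> blacks K) \<noteq> (y \<in> set (bd K) \<union> blacks K)"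
      using G(2) *(1) unfolding bipartite_def by blast
  qed
  have "blacks K \<subset> blacks G" using v(1) by (auto simp: F.blH E.blH)
  then have "card (blacks K) < card (blacks G)" using plabic_treeD(3)[OF G(1)] psubset_card_mono by blast
  then show ?thesis using that pK bip move_equiv_trans[OF mH mK] by blast
qed

lemma remove_all_black_deg2:
  assumes "plabic_tree G" "bipartite G" "bd G \<noteq> []"
  shows "\<exists>K. plabic_tree K \<and> bipartite K \<and> move_equiv G K \<and> (\<forall>v\<in>blacks K. deg K v \<noteq> 2)"
  using assms
proof (induction "card (blacks G)" arbitrary: G rule: less_induct)
  case less
  show ?case
  proof (cases "\<forall>v\<in>blacks G. deg G v \<noteq> 2")
    case True
    then show ?thesis using less.prems move_equiv_refl by blast
  next
    case False
    then obtain v where v: "v \<in> blacks G" "deg G v = 2" by blast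
    obtain K where K: "plabic_tree K" "bipartite K" "move_equiv G K" "card (blacks K) < card (blacks G)"
      by (rule remove_black_deg2[OF less.prems v])
    have "bd K \<noteq> []" using move_equiv_invariants(1)[OF K(3)] less.prems(3) by auto
    from less.hyps[OF K(4,1,2) this] show ?thesis using move_equiv_trans[OF K(3)] by blast
  qed
qed

subsection \<open>Tripods\<close>

text \<open>A half-open interval of the cycle, excluding \<open>s\<close> and including
  \<open>t\<close>; \<open>t\<close> may exceed \<open>n\<close>, so an arc may run past the last
  label.\<close>

definition arc :: "nat \<Rightarrow> nat \<Rightarrow> nat \<Rightarrow> nat list" where
  "arc n s t = map (\<lambda>i. i mod n) [Suc s..<Suc t]"

text \<open>The last alternative serves both ends of the arc from \<open>r\<close> around to
  \<open>p\<close>.\<close>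

definition hub :: "nat \<Rightarrow> nat \<Rightarrow> nat \<Rightarrow> nat \<Rightarrow> nat \<Rightarrow> nat" where
  "hub n p q r i = (if p < i \<and> i \<le> q then n else if q < i \<and> i \<le> r then n + 1 else n + 2)"

text \<open>The names \<open>0\<close> to \<open>n - 1\<close> are the boundary, \<open>n\<close> to
  \<open>n + 2\<close> the hubs, \<open>n + 3\<close> the centre. The parameters are the last
  members of the three arcs, so hub \<open>n\<close> carries \<open>p + 1\<close> to
  \<open>q\<close>.\<close>

definition tripod :: "nat \<Rightarrow> nat \<Rightarrow> nat \<Rightarrow> nat \<Rightarrow> nat plabic" where
  "tripod n p q r = \<lparr>bd = [0..<n], blacks = {n + 3}, whites = {n, n + 1, n + 2},
     rot = (\<lambda>x. if x < n then [hub n p q r x]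
       else if x = n then arc n p q @ [n + 3]
       else if x = n + 1 then arc n q r @ [n + 3]
       else if x = n + 2 then arc n r (n + p) @ [n + 3]
       else [n, n + 1, n + 2])\<rparr>"

lemma cyc_eq_if_successively:
  assumes "distinct xs" "distinct (y # ys)" "successively (cw_next xs) (y # ys)"
    "cw_next xs (last (y # ys)) y"
  shows "cyc_eq (y # ys) xs"
proof (rule cyc_eq_if_cw_next[OF assms(1,2)])
  fix i assume i: "i < length (y # ys)"
  show "cw_next xs ((y # ys) ! i) ((y # ys) ! (Suc i mod length (y # ys)))"
  proof (cases "Suc i < length (y # ys)")
    case True
    then show ?thesis using successively_conv_nth[of "cw_next xs" "y # ys"] assms(3) by simp
  next
    case False
    then have "i = length ys" using i by simp
    then show ?thesis using assms(4) by (simp add: last_conv_nth nth_Cons' split: if_splits)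
  qed
qed simp

lemma distinct_arc:
  assumes "t \<le> s + n"
  shows "distinct (arc n s t)"
proof -
  have inj: "i = j" if "s < i" "i \<le> t" "s < j" "j \<le> t" "i mod n = j mod n" "i \<le> j" for i j
  proof (rule ccontr)
    assume "i \<noteq> j"
    have "n dvd j - i" using that(5,6) by (metis mod_eq_dvd_iff_nat)
    moreover have "0 < j - i" "j - i < n" using that \<open>i \<noteq> j\<close> assms by auto
    ultimately show False using dvd_imp_le by fastforce
  qed
  have "inj_on (\<lambda>i. i mod n) (set [Suc s..<Suc t])"
  proof (rule inj_onI)
    fix i j assume "i \<in> set [Suc s..<Suc t]" "j \<in> set [Suc s..<Suc t]" and e: "i mod n = j mod n"
    then have "s < i" "i \<le> t" "s < j" "j \<le> t" by auto
    then show "i = j" using inj[of i j] inj[of j i] e by (cases "i \<le> j") auto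
  qed
  then show ?thesis unfolding arc_def by (simp add: distinct_map del: upt_Suc)
qed

lemma set_arc:
  assumes "t < n"
  shows "set (arc n s t) = {s<..t}"
proof -
  have "i mod n = i" if "i \<in> set [Suc s..<Suc t]" for i
  proof -
    have "i < n" using that assms by (simp del: upt_Suc)
    then show ?thesis by simp
  qed
  then have "arc n s t = [Suc s..<Suc t]" unfolding arc_def by (rule map_idI)
  then have "set (arc n s t) = {Suc s..<Suc t}" by (simp only: set_upt)
  also have "\<dots> = {s<..t}" by (simp only: atLeastLessThanSuc_atLeastAtMost atLeastSucAtMost_greaterThanAtMost)
  finally show ?thesis .
qed

lemma set_arc_wrap:
  assumes "p < r" "r < n"
  shows "set (arc n r (n + p)) = {..p} \<union> {r<..<n}"
proof -
  have e: "set (arc n r (n + p)) = (\<lambda>i. i mod n) ` {Suc r..<Suc (n + p)}"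
    unfolding arc_def by (simp only: set_map set_upt)
  show ?thesis
    unfolding e
  proof (intro equalityI subsetI)
    fix x assume "x \<in> (\<lambda>i. i mod n) ` {Suc r..<Suc (n + p)}"
    then obtain i where i: "x = i mod n" "r < i" "i \<le> n + p" by auto
    show "x \<in> {..p} \<union> {r<..<n}"
    proof (cases "i < n")
      case True
      then show ?thesis using i by simp
    next
      case False
      then have "i mod n = (i - n) mod n" by (simp add: le_mod_geq)
      also have "\<dots> = i - n" using i assms by (intro mod_less) linarith
      finally show ?thesis using i by (simp add: le_diff_conv)
    qed
  next
    fix x assume "x \<in> {..p} \<union> {r<..<n}"
    then consider "x \<le> p" | "r < x" "x < n" by auto
    then show "x \<in> (\<lambda>i. i mod n) ` {Suc r..<Suc (n + p)}"
    proof cases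
      case 1
      then have "x = (x + n) mod n" "x + n \<in> {Suc r..<Suc (n + p)}" using assms by auto
      then show ?thesis by blast
    next
      case 2
      then have "x = x mod n" "x \<in> {Suc r..<Suc (n + p)}" by auto
      then show ?thesis by blast
    qed
  qed
qed

section \<open>Recognising a tripod from its faces\<close>

text \<open>The normal form left by \<open>remove_all_black_deg2\<close> when the excess is
  1.\<close>

locale star =
  fixes G :: "nat plabic" and b :: nat
  assumes tree: "plabic_tree G" and bip: "bipartite G" and bne: "bd G \<noteq> []"
    and blacks: "blacks G = {b}" and degb: "deg G b = 3"
begin

abbreviation n :: nat where "n \<equiv> length (bd G)"
abbreviation B :: "nat \<Rightarrow> nat" where "B i \<equiv> bd G ! i"
text \<open>The unique neighbour of a boundary vertex; see \<open>rot_B\<close>.\<close>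

definition w :: "nat \<Rightarrow> nat" where "w i = hd (rot G (B i))"

lemma rs: "rotation_system G" using plabic_treeD(1)[OF tree] .

lemma n_pos: "0 < n" using bne by simp

lemma disj: "set (bd G) \<inter> internal G = {}" "b \<notin> whites G" "distinct (bd G)"
  using rs blacks by (auto simp: rotation_system_def)

lemma b_props: "b \<in> verts G" "b \<notin> set (bd G)" "b \<in> internal G"
  using blacks disj by (auto simp: internal_def verts_def)

lemma white_props: "x \<in> whites G \<Longrightarrow> x \<in> verts G \<and> x \<notin> set (bd G) \<and> x \<noteq> b"
  using disj by (auto simp: verts_def internal_def)

lemma verts_G: "verts G = set (bd G) \<union> {b} \<union> whites G"
  using blacks by (auto simp: verts_def internal_def)

lemma distinct_rot: "x \<in> verts G \<Longrightarrow> distinct (rot G x)"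
  using rs by (simp add: rotation_system_def)

lemma adj_black: "adj G x y \<Longrightarrow> x \<in> set (bd G) \<union> {b} \<Longrightarrow> y \<in> whites G"
  using bip blacks adj_verts[OF rs, of x y] unfolding bipartite_def verts_G by blast

lemma adj_white: "adj G x y \<Longrightarrow> x \<in> whites G \<Longrightarrow> y \<in> set (bd G) \<union> {b}"
  using bip blacks white_props[of x] unfolding bipartite_def by blast

lemma rot_B: "i < n \<Longrightarrow> rot G (B i) = [w i]"
proof -
  assume "i < n"
  then have "length (rot G (B i)) = 1" using tree by (simp add: plabic_tree_def deg_def)
  then show ?thesis by (auto simp: w_def length_Suc_conv)
qed

lemma adj_B: "i < n \<Longrightarrow> adj G (B i) x \<longleftrightarrow> x = w i"
  using rot_B by (auto simp: adj_def verts_def)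

lemma w_white: "i < n \<Longrightarrow> w i \<in> whites G"
  using adj_black[of "B i" "w i"] adj_B by simp

lemma adj_white_B: "adj G x (B i) \<Longrightarrow> i < n \<Longrightarrow> x = w i"
  using adj_sym[OF rs] adj_B by blast

text \<open>A white vertex not adjacent to \<open>b\<close> has only boundary neighbours by
  bipartiteness, and these are leaves; it would form a component without \<open>b\<close>.\<close>

lemma adj_b_iff: "adj G x b \<longleftrightarrow> x \<in> whites G"
proof
  assume "adj G x b"
  then show "x \<in> whites G" using adj_black[OF adj_sym[OF rs]] by blast
next
  assume x: "x \<in> whites G"
  show "adj G x b"
  proof (rule ccontr)
    assume nb: "\<not> adj G x b"
    have "x \<in> verts G" using white_props[OF x] by simp
    then have "(adj G)\<^sup>*\<^sup>* x b"
      using plabic_treeD(2)[OF tree] b_props(1) by (simp add: is_tree_def)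
    moreover have "z = x \<or> z \<in> set (bd G) \<and> adj G x z" if "(adj G)\<^sup>*\<^sup>* x z" for z
      using that
    proof (induction rule: rtranclp_induct)
      case (step y z)
      from step.IH show ?case
      proof
        assume "y = x"
        then have "adj G x z" using step.hyps(2) by simp
        then show ?thesis using adj_white[OF _ x, of z] nb by auto
      next
        assume y: "y \<in> set (bd G) \<and> adj G x y"
        then obtain i where i: "i < n" "y = B i" by (metis in_set_conv_nth)
        then have "x = w i" using y adj_white_B by blast
        moreover have "z = w i" using step.hyps(2) i adj_B by blast
        ultimately show ?thesis by simp
      qed
    qed simp
    ultimately have "b = x \<or> b \<in> set (bd G)" by blast
    then show False using white_props[OF x] b_props(2) by auto
  qed
qed

lemma set_rot_b: "set (rot G b) = whites G"
proof -
  have "x \<in> set (rot G b) \<longleftrightarrow> adj G x b" for x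
    using adj_sym[OF rs, of x b] adj_sym[OF rs, of b x] b_props(1) unfolding adj_def by blast
  then show ?thesis using adj_b_iff by blast
qed

lemma card_whites: "card (whites G) = 3"
  using distinct_card[OF distinct_rot[OF b_props(1)]] degb set_rot_b by (simp add: deg_def)

text \<open>White vertices have degree at least 2, so a face does not turn back there. Hence a face
  reaching a white vertex from \<open>b\<close> leaves to a boundary vertex.\<close>

lemma cw_next_white_neq:
  assumes "x \<in> whites G" "cw_next (rot G x) y z"
  shows "y \<noteq> z"
proof
  assume "y = z"
  let ?l = "length (rot G x)"
  obtain i where i: "i < ?l" "rot G x ! i = y" "rot G x ! (Suc i mod ?l) = z"
    using assms(2) by (auto simp: cw_next_def)
  have d: "distinct (rot G x)" using distinct_rot white_props[OF assms(1)] by blast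
  have l: "2 \<le> ?l"
    using deg_internal[OF tree bne, of x] assms(1) by (simp add: internal_def deg_def)
  then have "Suc i mod ?l < ?l" by (intro mod_less_divisor) linarith
  then have "Suc i mod ?l = i"
    using nth_eq_iff_index_eq[OF d] i \<open>y = z\<close> by metis
  then show False using i(1) l by (cases "Suc i = ?l") auto
qed

lemma step_end: "y \<in> set (bd G) \<Longrightarrow> (step G)\<^sup>*\<^sup>* (x, y) d \<Longrightarrow> d = (x, y)"
  by (erule converse_rtranclpE) (auto simp: step_def)

text \<open>The face from \<open>B i\<close> to its successor is followed step by step. At
  \<open>w i\<close> it meets a boundary vertex, where it ends, or \<open>b\<close>; beyond
  \<open>b\<close> it reaches a white vertex and must then end.\<close>

lemma succ_cases:
  assumes "i < n"
  obtains "w (Suc i mod n) = w i" "cw_next (rot G (w i)) (B i) (B (Suc i mod n))"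
    | "cw_next (rot G (w i)) (B i) b" "cw_next (rot G b) (w i) (w (Suc i mod n))"
      "cw_next (rot G (w (Suc i mod n))) b (B (Suc i mod n))"
proof -
  let ?j = "Suc i mod n"
  have j: "?j < n" using n_pos by simp
  have Bj: "B ?j \<in> set (bd G)" using j by simp
  obtain x y where xy: "adj G (B i) x" "(step G)\<^sup>*\<^sup>* (B i, x) (y, B ?j)"
    using tree assms unfolding plabic_tree_def boundary_clockwise_iff_step by blast
  have x: "x = w i" "x \<in> whites G" using xy(1) adj_B assms w_white by auto
  from xy(2) obtain s where s: "cw_next (rot G x) (B i) s" "(step G)\<^sup>*\<^sup>* (x, s) (y, B ?j)"
    using x white_props[OF x(2)] Bj by (cases rule: converse_rtranclpE) auto
  have "adj G x s" using cw_next_in[OF s(1)] white_props[OF x(2)] by (simp add: adj_def)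
  then consider "s \<in> set (bd G)" | "s = b" using adj_white x(2) by blast
  then show ?thesis
  proof cases
    case 1
    then have "s = B ?j" using step_end s(2) by blast
    moreover have "w ?j = w i" using adj_white_B[OF _ j, of x] \<open>adj G x s\<close> calculation x(1) by metis
    ultimately show ?thesis using that(1) s(1) x by blast
  next
    case 2
    from s(2)[unfolded 2] obtain x' where
      x': "cw_next (rot G b) x x'" "(step G)\<^sup>*\<^sup>* (b, x') (y, B ?j)"
      using b_props Bj by (cases rule: converse_rtranclpE) auto
    have x'w: "x' \<in> whites G" using cw_next_in[OF x'(1)] set_rot_b by blast
    from x'(2) obtain s' where s': "cw_next (rot G x') b s'" "(step G)\<^sup>*\<^sup>* (x', s') (y, B ?j)"
      using white_props[OF x'w] Bj by (cases rule: converse_rtranclpE) auto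
    have "adj G x' s'" using cw_next_in[OF s'(1)] white_props[OF x'w] by (simp add: adj_def)
    then have "s' \<in> set (bd G)" using adj_white x'w cw_next_white_neq[OF x'w s'(1)] by blast
    then have "s' = B ?j" using step_end s'(2) by blast
    moreover have "w ?j = x'" using adj_white_B[OF _ j, of x'] \<open>adj G x' s'\<close> calculation by metis
    ultimately show ?thesis using that(2) s(1) x x' s'(1) 2 by blast
  qed
qed

text \<open>The labels after which the face passes through \<open>b\<close>, that is, the last
  members of the three intervals.\<close>

definition cuts :: "nat set" where
  "cuts = {i. i < n \<and> cw_next (rot G (w i)) (B i) b}"

lemma cut:
  assumes "i \<in> cuts"
  shows "cw_next (rot G (w i)) (B i) b" "cw_next (rot G b) (w i) (w (Suc i mod n))"
    "cw_next (rot G (w (Suc i mod n))) b (B (Suc i mod n))"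
proof -
  have i: "i < n" "cw_next (rot G (w i)) (B i) b" using assms by (auto simp: cuts_def)
  have "B (Suc i mod n) \<noteq> b" using b_props n_pos by (metis mod_less_divisor nth_mem)
  then show "cw_next (rot G (w i)) (B i) b" "cw_next (rot G b) (w i) (w (Suc i mod n))"
    "cw_next (rot G (w (Suc i mod n))) b (B (Suc i mod n))"
    using succ_cases[OF i(1)] i cw_next_unique[OF distinct_rot] white_props[OF w_white[OF i(1)]]
    by metis+
qed

lemma not_cut:
  assumes "i < n" "i \<notin> cuts"
  shows "w (Suc i mod n) = w i" "cw_next (rot G (w i)) (B i) (B (Suc i mod n))"
  using succ_cases[OF assms(1)] assms by (auto simp: cuts_def)

text \<open>At each white vertex exactly one neighbour precedes \<open>b\<close> in the rotation. It
  is a boundary vertex by \<open>cw_next_white_neq\<close>, and its label is the cut belonging to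
  that white vertex.\<close>

lemma w_cuts: "bij_betw w cuts (whites G)"
proof (rule bij_betwI')
  fix i j assume i: "i \<in> cuts" and j: "j \<in> cuts"
  show "w i = w j \<longleftrightarrow> i = j"
  proof
    assume e: "w i = w j"
    have n: "i < n" "j < n" using i j by (auto simp: cuts_def)
    have "distinct (rot G (w i))" using distinct_rot white_props[OF w_white[OF n(1)]] by blast
    then have "B i = B j" by (rule cw_next_unique_pred[OF _ cut(1)[OF i] cut(1)[OF j, folded e]])
    then show "i = j" using n nth_eq_iff_index_eq[OF disj(3)] by blast
  qed simp
next
  fix i assume "i \<in> cuts"
  then show "w i \<in> whites G" using w_white by (simp add: cuts_def)
next
  fix x assume x: "x \<in> whites G"
  then have "b \<in> set (rot G x)" using adj_b_iff by (auto simp: adj_def)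
  then obtain l where l: "l < length (rot G x)" "rot G x ! l = b" by (metis in_set_conv_nth)
  \<comment> \<open>The index before \<open>l\<close>, cyclically; adding the length keeps the
    subtraction exact for \<open>l = 0\<close>.\<close>
  let ?k = "(l + length (rot G x) - 1) mod length (rot G x)"
  have "?k < length (rot G x)" using l by (intro mod_less_divisor) linarith
  moreover have "Suc (l + length (rot G x) - 1) = l + length (rot G x)" using l by linarith
  then have "Suc ?k mod length (rot G x) = (l + length (rot G x)) mod length (rot G x)"
    by (metis mod_Suc_eq)
  then have "Suc ?k mod length (rot G x) = l" using l(1) by simp
  ultimately have "cw_next (rot G x) (rot G x ! ?k) b" unfolding cw_next_def using l(2) by metis
  then obtain s where s: "cw_next (rot G x) s b" ..
  have a: "adj G x s" using cw_next_in[OF s] white_props[OF x] by (simp add: adj_def)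
  then have "s \<in> set (bd G)" using adj_white[OF a x] cw_next_white_neq[OF x s] by simp
  then obtain i where i: "i < n" "s = B i" by (metis in_set_conv_nth)
  then have x: "x = w i" using a adj_white_B[of x i] by simp
  moreover have "i \<in> cuts" using i(1) s unfolding x i(2) cuts_def by simp
  ultimately show "\<exists>i\<in>cuts. x = w i" by blast
qed

lemma card_cuts: "card cuts = 3"
  using bij_betw_same_card[OF w_cuts] card_whites by simp

lemma w_const:
  assumes "i \<le> j" "\<And>k. i \<le> k \<Longrightarrow> k < j \<Longrightarrow> k mod n \<notin> cuts"
  shows "w (i mod n) = w (j mod n)"
  using assms
proof (induction j rule: dec_induct)
  case (step j)
  have "w (i mod n) = w (j mod n)"
    by (rule step.IH) (rule step.prems, simp_all)
  moreover have "j mod n \<notin> cuts" by (rule step.prems) (use step.hyps in simp_all)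
  then have "w (Suc (j mod n) mod n) = w (j mod n)" using n_pos by (intro not_cut) simp_all
  ultimately show ?case by (simp only: mod_Suc_eq)
qed simp

text \<open>For consecutive cuts \<open>s\<close> and \<open>t\<close>, counted past
  \<open>n\<close> where necessary, \<open>b\<close> followed by the boundary vertices of the arc is
  a closed chain of successors in the rotation of \<open>w (t mod n)\<close>. By
  \<open>cyc_eq_if_cw_next\<close> such a chain is the whole rotation.\<close>

lemma rot_white:
  assumes st: "s < t" "t \<le> s + n" and cuts: "s mod n \<in> cuts" "t mod n \<in> cuts"
    "\<And>k. s < k \<Longrightarrow> k < t \<Longrightarrow> k mod n \<notin> cuts"
  shows "cyc_eq (map B (arc n s t) @ [b]) (rot G (w (t mod n)))"
    and "\<And>k. s < k \<Longrightarrow> k \<le> t \<Longrightarrow> w (k mod n) = w (t mod n)"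
proof -
  let ?W = "w (t mod n)" and ?R = "rot G (w (t mod n))"
  show k: "w (k mod n) = ?W" if "s < k" "k \<le> t" for k
    by (rule w_const[OF that(2)]) (use cuts(3) that in simp)
  have n: "k mod n < n" for k using n_pos by simp
  have R: "distinct ?R" using distinct_rot white_props[OF w_white[OF n]] by blast
  have "inj_on B {..<n}" using disj(3) by (simp add: inj_on_nth)
  then have "inj_on B (set (arc n s t))"
    by (rule inj_on_subset) (use n in \<open>auto simp: arc_def\<close>)
  then have "distinct (map B (arc n s t))" using distinct_arc[OF st(2)] by (simp add: distinct_map)
  moreover have "b \<notin> set (map B (arc n s t))" using b_props(2) n by (auto simp: arc_def)
  ultimately have dist: "distinct (b # map B (arc n s t))" by simp
  have "successively (cw_next ?R) (map (\<lambda>i. B (i mod n)) [Suc s..<Suc t])"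
    unfolding successively_conv_nth
  proof (intro allI impI)
    fix i assume i: "Suc i < length (map (\<lambda>i. B (i mod n)) [Suc s..<Suc t])"
    then have "cw_next (rot G (w (Suc (s + i) mod n))) (B (Suc (s + i) mod n)) (B (Suc (Suc (s + i) mod n) mod n))"
      using cuts(3)[of "Suc (s + i)"] n by (intro not_cut) (auto simp del: upt_Suc)
    moreover have "w (Suc (s + i) mod n) = ?W" using i by (intro k) (auto simp del: upt_Suc)
    ultimately have "cw_next ?R (B (Suc (s + i) mod n)) (B (Suc (Suc (s + i)) mod n))"
      by (simp only: mod_Suc_eq)
    then show "cw_next ?R (map (\<lambda>i. B (i mod n)) [Suc s..<Suc t] ! i)
      (map (\<lambda>i. B (i mod n)) [Suc s..<Suc t] ! Suc i)" using i by (simp del: upt_Suc)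
  qed
  moreover have "map (\<lambda>i. B (i mod n)) [Suc s..<Suc t] = map B (arc n s t)"
    by (simp add: arc_def del: upt_Suc)
  ultimately have succ: "successively (cw_next ?R) (map B (arc n s t))" by simp
  have "cw_next (rot G (w (Suc (s mod n) mod n))) b (B (Suc (s mod n) mod n))"
    using cut(3)[OF cuts(1)] .
  then have first: "cw_next ?R b (B (Suc s mod n))"
    using k[of "Suc s"] st by (simp only: mod_Suc_eq lessI Suc_leI)
  have last: "cw_next ?R (B (t mod n)) b" using cut(1)[OF cuts(2)] .
  have ne: "arc n s t \<noteq> []" "hd (arc n s t) = Suc s mod n" "last (arc n s t) = t mod n"
    using st by (auto simp: arc_def hd_map last_map hd_upt simp del: upt_Suc)
  have "cyc_eq (b # map B (arc n s t)) ?R"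
  proof (rule cyc_eq_if_successively[OF R dist])
    show "successively (cw_next ?R) (b # map B (arc n s t))"
      using succ first ne by (simp add: successively_Cons hd_map)
    show "cw_next ?R (last (b # map B (arc n s t))) b"
      using last ne by (simp add: last_map)
  qed
  then show "cyc_eq (map B (arc n s t) @ [b]) ?R"
    using cyc_eq_trans[OF cyc_eq_append[of "map B (arc n s t)" "[b]"]] by simp
qed

lemma isotopic_tripod:
  obtains p q r where "p < q" "q < r" "r < n" "isotopic (tripod n p q r) G"
proof -
  have fin: "finite cuts" by (simp add: cuts_def)
  have "\<exists>p q r. xs = [p, q, r]" if "length xs = 3" for xs :: "nat list"
    using that by (auto simp: length_Suc_conv numeral_3_eq_3)
  from this[of "sorted_list_of_set cuts"] obtain p q r where l: "sorted_list_of_set cuts = [p, q, r]"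
    using card_cuts by auto
  then have cuts: "cuts = {p, q, r}" using set_sorted_list_of_set[OF fin] by simp
  have "sorted_wrt (<) [p, q, r]" using strict_sorted_list_of_set[of cuts] unfolding l .
  then have pq: "p < q" "q < r" by simp_all
  have "r \<in> cuts" using cuts by simp
  then have r: "r < n" by (simp add: cuts_def)
  have q: "q < n" and p: "p < n" using pq r by linarith+
  have mods: "p mod n = p" "q mod n = q" "r mod n = r" "(n + p) mod n = p" using p q r by simp_all
  have c1: "k mod n \<notin> cuts" if "p < k" "k < q" for k
  proof -
    have "k mod n = k" using that q by simp
    then show ?thesis using that pq unfolding cuts by simp
  qed
  have c2: "k mod n \<notin> cuts" if "q < k" "k < r" for k
  proof -
    have "k mod n = k" using that r by simp
    then show ?thesis using that pq unfolding cuts by simp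
  qed
  \<comment> \<open>The third arc ends at \<open>n + p\<close>; indices from \<open>n\<close> on
    reduce to labels below \<open>p\<close>.\<close>
  have c3: "k mod n \<notin> cuts" if "r < k" "k < n + p" for k
  proof (cases "k < n")
    case True
    then have "k mod n = k" by simp
    then show ?thesis using that pq unfolding cuts by simp
  next
    case False
    then have "k mod n = (k - n) mod n" by (simp add: le_mod_geq)
    also have "\<dots> = k - n" using that p by (intro mod_less) linarith
    finally have "k mod n < p" using that False by linarith
    then show ?thesis using pq unfolding cuts by simp
  qed
  have m: "p mod n \<in> cuts" "q mod n \<in> cuts" "r mod n \<in> cuts" "(n + p) mod n \<in> cuts"
    unfolding mods cuts by simp_all
  have le: "q \<le> p + n" "r \<le> q + n" "n + p \<le> r + n" "r < n + p" using pq p q r by linarith+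
  have r1: "cyc_eq (map B (arc n p q) @ [b]) (rot G (w q))"
    by (rule rot_white(1)[OF pq(1) le(1) m(1,2), unfolded mods]) (rule c1)
  have k1: "w (k mod n) = w q" if "p < k" "k \<le> q" for k
    by (rule rot_white(2)[OF pq(1) le(1) m(1,2) _ that, unfolded mods]) (rule c1)
  have r2: "cyc_eq (map B (arc n q r) @ [b]) (rot G (w r))"
    by (rule rot_white(1)[OF pq(2) le(2) m(2,3), unfolded mods]) (rule c2)
  have k2: "w (k mod n) = w r" if "q < k" "k \<le> r" for k
    by (rule rot_white(2)[OF pq(2) le(2) m(2,3) _ that, unfolded mods]) (rule c2)
  have r3: "cyc_eq (map B (arc n r (n + p)) @ [b]) (rot G (w p))"
    by (rule rot_white(1)[OF le(4,3) m(3,4), unfolded mods]) (rule c3)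
  have k3: "w (k mod n) = w p" if "r < k" "k \<le> n + p" for k
    by (rule rot_white(2)[OF le(4,3) m(3,4) _ that, unfolded mods]) (rule c3)
  have ws: "whites G = {w q, w r, w p}" "w q \<noteq> w r" "w r \<noteq> w p" "w q \<noteq> w p"
    using w_cuts pq unfolding cuts bij_betw_def inj_on_def by auto
  \<comment> \<open>The successor of a cut lies in the next arc, so \<open>cut\<close> gives the
    cyclic order of the white vertices around \<open>b\<close>.\<close>
  have "w (Suc p mod n) = w q" by (rule k1) (use pq in linarith)+
  moreover have "w (Suc q mod n) = w r" by (rule k2) (use pq in linarith)+
  moreover have "w (Suc r mod n) = w p" by (rule k3) (use le in linarith)+
  ultimately have succ: "cw_next (rot G b) (w p) (w q)" "cw_next (rot G b) (w q) (w r)"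
    "cw_next (rot G b) (w r) (w p)"
    using cut(2)[OF m(1)] cut(2)[OF m(2)] cut(2)[OF m(3)] unfolding mods by simp_all
  have rb: "cyc_eq [w q, w r, w p] (rot G b)"
    by (rule cyc_eq_if_successively[OF distinct_rot[OF b_props(1)]]) (use ws succ in auto)
  \<comment> \<open>Each hub goes to the white vertex attached to the last label of its arc.\<close>
  define f where "f x = (if x < n then B x else if x = n then w q else if x = n + 1 then w r
    else if x = n + 2 then w p else b)" for x
  have f: "f x = B x" if "x < n" for x using that by (simp add: f_def)
  have fs: "f n = w q" "f (Suc n) = w r" "f (Suc (Suc n)) = w p" "f (n + 3) = b" "f (n + 1) = w r" "f (n + 2) = w p"
    by (auto simp: f_def)
  have "f ` {..<n} = B ` {..<n}" by (rule image_cong) (use f in auto)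
  also have "\<dots> = set (bd G)" by (auto simp: set_conv_nth)
  finally have fB: "f ` {..<n} = set (bd G)" .
  have fmap: "map f (arc n s t) = map B (arc n s t)" for s t
  proof (rule map_cong[OF refl])
    fix x assume "x \<in> set (arc n s t)"
    then have "x < n" using n_pos by (auto simp: arc_def simp del: upt_Suc)
    then show "f x = B x" by (rule f)
  qed
  have vT: "verts (tripod n p q r) = {..<n} \<union> {n, n + 1, n + 2, n + 3}"
    by (auto simp: verts_def internal_def tripod_def)
  have hub: "f (hub n p q r x) = w x" if "x < n" for x
  proof -
    have xm: "x mod n = x" "(n + x) mod n = x" using that by simp_all
    consider "p < x" "x \<le> q" | "q < x" "x \<le> r" | "r < x" | "x \<le> p" by linarith
    then show ?thesis
    proof cases
      case 1
      then have "hub n p q r x = n" by (simp add: hub_def)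
      then show ?thesis using k1[OF 1] by (simp only: xm fs)
    next
      case 2
      then have "hub n p q r x = n + 1" by (simp add: hub_def)
      then show ?thesis using k2[OF 2] by (simp only: xm fs)
    next
      case 3
      then have "hub n p q r x = n + 2" using pq by (simp add: hub_def)
      moreover have "x \<le> n + p" using that by simp
      ultimately show ?thesis using k3[OF 3] by (simp only: xm fs)
    next
      case 4
      then have "hub n p q r x = n + 2" using pq by (simp add: hub_def)
      moreover have "r < n + x" "n + x \<le> n + p" using 4 r by simp_all
      ultimately show ?thesis using k3[of "n + x"] by (simp only: xm fs)
    qed
  qed
  have "inj_on f ({..<n} \<union> {n, n + 1, n + 2, n + 3})"
  proof -
    have "inj_on f {..<n}" using disj(3) f by (auto simp: inj_on_def nth_eq_iff_index_eq)
    moreover have "inj_on f {n, n + 1, n + 2, n + 3}"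
      using ws white_props by (auto simp: inj_on_def fs f_def)
    moreover have "f ` {n, n + 1, n + 2, n + 3} = internal G"
      using ws by (auto simp: fs internal_def blacks)
    ultimately show ?thesis using disj(1) fB unfolding inj_on_Un by blast
  qed
  moreover have "f ` ({..<n} \<union> {n, n + 1, n + 2, n + 3}) = verts G"
    using ws by (auto simp: fB image_Un fs verts_G)
  ultimately have "bij_betw f (verts (tripod n p q r)) (verts G)" unfolding vT by (simp add: bij_betw_def)
  moreover have "map f (bd (tripod n p q r)) = bd G"
  proof -
    have "map f [0..<n] = map B [0..<n]" by (rule map_cong[OF refl]) (use f in simp)
    also have "\<dots> = bd G" by (rule map_nth)
    finally show ?thesis by (simp add: tripod_def)
  qed
  moreover have "f ` blacks (tripod n p q r) = blacks G" "f ` whites (tripod n p q r) = whites G"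
    unfolding ws(1) blacks tripod_def by (simp_all only: plabic.simps image_insert image_empty fs)
  moreover have "cyc_eq (map f (rot (tripod n p q r) v)) (rot G (f v))" if vin: "v \<in> verts (tripod n p q r)" for v
  proof -
    have rotT: "v < n \<Longrightarrow> rot (tripod n p q r) v = [hub n p q r v]"
      "rot (tripod n p q r) n = arc n p q @ [n + 3]"
      "rot (tripod n p q r) (n + 1) = arc n q r @ [n + 3]"
      "rot (tripod n p q r) (n + 2) = arc n r (n + p) @ [n + 3]"
      "rot (tripod n p q r) (n + 3) = [n, n + 1, n + 2]"
      by (simp_all add: tripod_def)
    consider "v < n" | "v = n" | "v = n + 1" | "v = n + 2" | "v = n + 3" using vin unfolding vT by blast
    then show ?thesis
    proof cases
      case 1
      then have "map f (rot (tripod n p q r) v) = rot G (f v)"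
        by (simp only: rotT(1) list.map hub f rot_B)
      then show ?thesis by simp
    next
      case 2
      show ?thesis unfolding 2 rotT map_append fmap list.map fs by (rule r1)
    next
      case 3
      show ?thesis unfolding 3 rotT map_append fmap list.map fs by (rule r2)
    next
      case 4
      show ?thesis unfolding 4 rotT map_append fmap list.map fs by (rule r3)
    next
      case 5
      show ?thesis unfolding 5 rotT list.map fs by (rule rb)
    qed
  qed
  ultimately have "isotopic (tripod n p q r) G" unfolding isotopic_def by blast
  with pq r show ?thesis using that by blast
qed

end

subsection \<open>Balance\<close>

lemma side_verts: "rotation_system G \<Longrightarrow> u \<in> verts G \<Longrightarrow> x \<in> side G u v \<Longrightarrow> x \<in> verts G"
proof -
  assume rs: "rotation_system G" and u: "u \<in> verts G" and "x \<in> side G u v"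
  from this(3) show ?thesis
    by (induction rule: side_induct) (use u adj_verts[OF rs] in auto)
qed

lemma side_rev:
  assumes "rotation_system G" "x \<in> side G u v"
  shows "(\<lambda>a b. adj G a b \<and> {a, b} \<noteq> {u, v})\<^sup>*\<^sup>* x u"
proof -
  have "symp (\<lambda>a b. adj G a b \<and> {a, b} \<noteq> {u, v})"
    using adj_sym[OF assms(1)] unfolding symp_def by (metis insert_commute)
  then show "(\<lambda>a b. adj G a b \<and> {a, b} \<noteq> {u, v})\<^sup>*\<^sup>* x u"
    using assms(2) by (auto simp: side_def dest: sympD[OF symp_rtranclp])
qed

lemma side_swap:
  assumes "rotation_system G" "v \<in> side G u v"
  shows "u \<in> side G v u"
  using side_rev[OF assms] unfolding side_def insert_commute[of v u] by simp

lemma side_Un: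
  assumes "rotation_system G" "is_tree G" "adj G u v"
  shows "side G u v \<union> side G v u = verts G"
proof -
  have "x \<in> side G u v \<union> side G v u" if "(adj G)\<^sup>*\<^sup>* u x" for x
    using that
  proof (induction rule: rtranclp_induct)
    case (step y z)
    show ?case
    proof (cases "{y, z} = {u, v}")
      case True
      then have "z = u \<or> z = v" by (auto simp: doubleton_eq_iff)
      then show ?thesis using side_refl[of u G v] side_refl[of v G u] by blast
    next
      case False
      moreover have "{v, u} = {u, v}" by (rule insert_commute)
      ultimately show ?thesis
        using step.IH side_step[OF _ step.hyps(2), of u v] side_step[OF _ step.hyps(2), of v u]
        by auto
    qed
  qed simp
  moreover have "(adj G)\<^sup>*\<^sup>* u x" if "x \<in> verts G" for x
    using assms(2) adj_verts[OF assms(1,3)] that by (simp add: is_tree_def)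
  ultimately have "verts G \<subseteq> side G u v \<union> side G v u" by blast
  moreover have "side G u v \<subseteq> verts G" "side G v u \<subseteq> verts G"
    using side_verts[OF assms(1)] adj_verts[OF assms(1,3)] by blast+
  ultimately show ?thesis by blast
qed

lemma tree_bridge: "rotation_system G \<Longrightarrow> is_tree G \<Longrightarrow> adj G u v \<Longrightarrow> v \<notin> side G u v"
proof -
  assume "rotation_system G" "is_tree G" and a: "adj G u v"
  then have "\<forall>u v. adj G u v \<longrightarrow> v \<notin> side G u v"
    using acyclic_iff_bridges[of G] unfolding is_tree_def by simp
  with a show ?thesis by simp
qed

lemma side_Int:
  assumes "rotation_system G" "is_tree G" "adj G u v"
  shows "side G u v \<inter> side G v u = {}"
proof (rule ccontr)
  assume "side G u v \<inter> side G v u \<noteq> {}"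
  then obtain x where x: "x \<in> side G u v" "x \<in> side G v u" by blast
  have "(\<lambda>a b. adj G a b \<and> {a, b} \<noteq> {u, v})\<^sup>*\<^sup>* x v"
    using side_rev[OF assms(1) x(2)] unfolding insert_commute[of v u] .
  moreover have "(\<lambda>a b. adj G a b \<and> {a, b} \<noteq> {u, v})\<^sup>*\<^sup>* u x" using x(1) by (simp add: side_def)
  ultimately have "(\<lambda>a b. adj G a b \<and> {a, b} \<noteq> {u, v})\<^sup>*\<^sup>* u v" by (rule rtranclp_trans[rotated])
  then have "v \<in> side G u v" by (simp add: side_def)
  then show False using tree_bridge[OF assms] by blast
qed

text \<open>The quantity that \<open>balanced\<close> confines between 1 and \<open>m\<close>, for
  the side of \<open>u\<close>.\<close>

definition load :: "nat \<Rightarrow> 'v plabic \<Rightarrow> 'v \<Rightarrow> 'v \<Rightarrow> int" where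
  "load m G u v = int (card (set (bd G) \<inter> side G u v))
     - int m * (\<Sum>b\<in>side G u v \<inter> blacks G. int (deg G b) - 2)"

lemma balanced_iff_load:
  "balanced m G \<longleftrightarrow> (\<forall>u v. adj G u v \<longrightarrow> 1 \<le> load m G u v \<and> load m G u v \<le> int m)"
  by (simp add: balanced_def load_def Let_def)

text \<open>The two sides partition the boundary and the black vertices, so the loads add up to the
  totals. For length \<open>2 * m + 1\<close> and excess 1 the sum is \<open>m + 1\<close>, so the
  bounds 1 and \<open>m\<close> on one side give them on the other.\<close>

lemma load_swap:
  assumes "plabic_tree G" "adj G u v"
  shows "load m G u v + load m G v u = int (length (bd G)) - int m * excess G"
proof -
  note rs = plabic_treeD(1)[OF assms(1)] and tr = plabic_treeD(2)[OF assms(1)]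
  let ?U = "side G u v" and ?V = "side G v u"
  note un = side_Un[OF rs tr assms(2)] and int = side_Int[OF rs tr assms(2)]
  have "set (bd G) = set (bd G) \<inter> ?U \<union> set (bd G) \<inter> ?V" using un by (auto simp: verts_def)
  then have "card (set (bd G)) = card (set (bd G) \<inter> ?U) + card (set (bd G) \<inter> ?V)"
    using int by (metis (no_types, lifting) List.finite_set card_Un_disjoint finite_Int inf_assoc inf_commute inf_bot_right)
  moreover have "card (set (bd G)) = length (bd G)"
    using rs by (simp add: rotation_system_def distinct_card)
  moreover have "blacks G = ?U \<inter> blacks G \<union> ?V \<inter> blacks G" using un by (auto simp: verts_def internal_def)
  then have "excess G = (\<Sum>b\<in>?U \<inter> blacks G. int (deg G b) - 2) + (\<Sum>b\<in>?V \<inter> blacks G. int (deg G b) - 2)"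
    unfolding excess_def using int plabic_treeD(3)[OF assms(1)]
    by (subst sum.union_disjoint[symmetric]) auto
  ultimately show ?thesis unfolding load_def by (simp add: algebra_simps)
qed

lemma linked_not_branching: "linked G x y \<Longrightarrow> y = x \<or> y \<notin> branching G"
  by (induction rule: linked_induct) auto

text \<open>A class of \<open>links G\<close> lies on one side of an edge at the trivalent black vertex, where the
  balance condition only counts leaves.\<close>

lemma card_links_le:
  assumes G: "amplitree 2 m G" and i: "i < length (bd G)"
  shows "card {j. (i, j) \<in> links G} \<le> m"
proof -
  have pt: "plabic_tree G" and bal: "balanced m G" and ex: "excess G = 1"
    using G by (auto simp: amplitree_def has_type_def excess_def)
  note rs = plabic_treeD(1)[OF pt] and tr = plabic_treeD(2)[OF pt]
  have ne: "bd G \<noteq> []" using i by auto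
  obtain b where b: "b \<in> blacks G" "deg G b = 3" "branching G = {b}"
    "\<And>x. x \<in> blacks G \<Longrightarrow> x \<noteq> b \<Longrightarrow> deg G x = 2"
    using excess_1[OF pt ne ex] by blast
  let ?s = "bd G ! i"
  have s: "?s \<in> set (bd G)" using i by simp
  then have sb: "?s \<noteq> b" using rs b(1) by (auto simp: rotation_system_def internal_def)
  have "?s \<in> verts G" "b \<in> verts G" using s b(1) by (auto simp: verts_def internal_def)
  then have "(adj G)\<^sup>*\<^sup>* ?s b" using tr by (simp add: is_tree_def)
  \<comment> \<open>Along a path to \<open>b\<close> the vertices stay linked to \<open>?s\<close>
    until the step that enters \<open>b\<close>; the vertex before that step serves as
    \<open>w\<close>.\<close>
  moreover have "linked G ?s y \<or> (\<exists>w. linked G ?s w \<and> w \<noteq> b \<and> adj G w b)" if "(adj G)\<^sup>*\<^sup>* ?s y" for y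
    using that
  proof (induction rule: rtranclp_induct)
    case (step y z)
    show ?case
    proof (cases "\<exists>w. linked G ?s w \<and> w \<noteq> b \<and> adj G w b")
      case False
      then have l: "linked G ?s y" using step.IH by blast
      have "y \<noteq> b"
        using linked_not_branching[OF l] sb unfolding b(3) by blast
      moreover have "z \<noteq> b" using False l step.hyps(2) calculation by blast
      ultimately show ?thesis using linked_step[OF l step.hyps(2)] b(3) by simp
    qed blast
  qed simp
  ultimately have "linked G ?s b \<or> (\<exists>w. linked G ?s w \<and> w \<noteq> b \<and> adj G w b)" by blast
  moreover have "\<not> linked G ?s b"
    using linked_not_branching[of G ?s b] sb unfolding b(3) by blast
  ultimately obtain w where w: "linked G ?s w" "w \<noteq> b" "adj G w b" by blast
  have side: "y \<in> side G w b" if "linked G ?s y" for y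
  proof -
    have "linked G w y" using linked_trans[OF linked_sym[OF rs w(1)] that] .
    then show ?thesis
    proof (induction rule: linked_induct)
      case (step y z)
      then have "y \<noteq> b" "z \<noteq> b" using b(3) by auto
      then have "{y, z} \<noteq> {w, b}" by (rule doubleton_neq)
      from side_step[OF step.IH step.hyps(2) this] show ?case .
    qed simp
  qed
  have bs: "b \<notin> side G w b" by (rule tree_bridge[OF rs tr w(3)])
  \<comment> \<open>All black vertices other than \<open>b\<close> have degree 2 and contribute
    0.\<close>
  then have "(\<Sum>x\<in>side G w b \<inter> blacks G. int (deg G x) - 2) = 0"
    using b(4) by (intro sum.neutral) force
  then have "load m G w b = int (card (set (bd G) \<inter> side G w b))" by (simp add: load_def)
  moreover have "load m G w b \<le> int m" using bal w(3) unfolding balanced_iff_load by blast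
  ultimately have le: "card (set (bd G) \<inter> side G w b) \<le> m" by simp
  have "inj_on (\<lambda>j. bd G ! j) {j. (i, j) \<in> links G}"
    using rs by (auto simp: inj_on_def links_def rotation_system_def nth_eq_iff_index_eq)
  moreover have "(\<lambda>j. bd G ! j) ` {j. (i, j) \<in> links G} \<subseteq> set (bd G) \<inter> side G w b"
    using side by (auto simp: links_def)
  ultimately have "card {j. (i, j) \<in> links G} \<le> card (set (bd G) \<inter> side G w b)"
    by (rule card_inj_on_le) simp
  with le show ?thesis by simp
qed

subsection \<open>Tripods are plabic trees\<close>

lemma length_arc: "length (arc n s t) = t - s"
  by (simp add: arc_def del: upt_Suc)

text \<open>This and the next two lemmas give the turns at a hub, whose rotation is an arc followed
  by the centre \<open>e\<close>: between two leaves, into the centre, and out of it.\<close>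

lemma cw_next_arc:
  assumes "s < k" "k < t"
  shows "cw_next (arc n s t @ [e]) (k mod n) (Suc k mod n)"
proof -
  have "[Suc s..<Suc t] = [Suc s..<k] @ [k..<Suc t]"
    using upt_add_eq_append[of "Suc s" k "Suc t - k"] assms by (simp del: upt_Suc)
  also have "[k..<Suc t] = k # Suc k # [Suc (Suc k)..<Suc t]"
    using assms by (simp add: upt_conv_Cons del: upt_Suc)
  finally have "[Suc s..<Suc t] = [Suc s..<k] @ k # Suc k # [Suc (Suc k)..<Suc t]" .
  then show ?thesis
    using cw_next_append[of "map (\<lambda>i. i mod n) [Suc s..<k]" "k mod n" "Suc k mod n"
      "map (\<lambda>i. i mod n) [Suc (Suc k)..<Suc t] @ [e]"]
    by (simp add: arc_def del: upt_Suc)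
qed

lemma cw_next_arc_last: "s < t \<Longrightarrow> cw_next (arc n s t @ [e]) (t mod n) e"
  using cw_next_append[of "map (\<lambda>i. i mod n) [Suc s..<t]" "t mod n" e "[]"]
  by (simp add: arc_def)

lemma cw_next_arc_first: "s < t \<Longrightarrow> cw_next (arc n s t @ [e]) e (Suc s mod n)"
  using cw_next_wrap[of "Suc s mod n" "map (\<lambda>i. i mod n) [Suc (Suc s)..<Suc t]" e]
  by (simp add: arc_def upt_conv_Cons del: upt_Suc)

locale tripod_params =
  fixes n p q r :: nat
  assumes pq: "p < q" "q < r" "r < n"
begin

abbreviation T :: "nat plabic" where "T \<equiv> tripod n p q r"
abbreviation h :: "nat \<Rightarrow> nat" where "h \<equiv> hub n p q r"
abbreviation W :: "nat set" where "W \<equiv> {n, n + 1, n + 2}"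
abbreviation L :: "nat \<Rightarrow> nat set" where "L a \<equiv> {x. x < n \<and> h x = a}"

lemma T_simps: "bd T = [0..<n]" "blacks T = {n + 3}" "whites T = W"
  by (simp_all add: tripod_def)

lemma verts_T: "verts T = {..<n} \<union> W \<union> {n + 3}"
  unfolding verts_def internal_def T_simps by auto

lemma rot_T: "x < n \<Longrightarrow> rot T x = [h x]" "rot T n = arc n p q @ [n + 3]"
  "rot T (n + 1) = arc n q r @ [n + 3]" "rot T (n + 2) = arc n r (n + p) @ [n + 3]"
  "rot T (n + 3) = [n, n + 1, n + 2]"
  by (simp_all add: tripod_def)

lemma h_W: "h x \<in> W"
  by (simp add: hub_def)

lemma L_eq: "L n = {p<..q}" "L (n + 1) = {q<..r}" "L (n + 2) = {..p} \<union> {r<..<n}"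
  using pq by (auto simp: hub_def)

lemma set_rot_W: "a \<in> W \<Longrightarrow> set (rot T a) = insert (n + 3) (L a)"
proof -
  assume "a \<in> W"
  then consider "a = n" | "a = n + 1" | "a = n + 2" by blast
  then show ?thesis
  proof cases
    case 1
    have "q < n" using pq by linarith
    then show ?thesis unfolding 1 rot_T L_eq by (simp add: set_arc)
  next
    case 2
    show ?thesis unfolding 2 rot_T L_eq using pq by (simp add: set_arc)
  next
    case 3
    have "p < r" using pq by linarith
    then show ?thesis unfolding 3 rot_T L_eq using pq by (simp add: set_arc_wrap)
  qed
qed

lemma adj_leaf: "x < n \<Longrightarrow> adj T x y \<longleftrightarrow> y = h x"
  unfolding adj_def verts_T by (simp add: rot_T)

lemma adj_W: "a \<in> W \<Longrightarrow> adj T a y \<longleftrightarrow> y = n + 3 \<or> y \<in> L a"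
  unfolding adj_def verts_T by (auto simp: set_rot_W)

lemma adj_center: "adj T (n + 3) y \<longleftrightarrow> y \<in> W"
  unfolding adj_def verts_T by (simp add: rot_T)

lemma adj_T_cases [consumes 1]:
  assumes "adj T x y"
  obtains "x < n" "y = h x" | "y < n" "x = h y" | "x \<in> W" "y = n + 3" | "x = n + 3" "y \<in> W"
proof -
  have "x \<in> {..<n} \<union> W \<union> {n + 3}" using assms unfolding adj_def verts_T by blast
  then consider "x < n" | "x \<in> W" | "x = n + 3" by blast
  then show ?thesis
  proof cases
    case 1
    then show ?thesis using assms adj_leaf that(1) by blast
  next
    case 2
    then show ?thesis using assms adj_W[OF 2, of y] that(2,3) 2 by (simp only: mem_Collect_eq) metis
  next
    case 3
    then show ?thesis using assms adj_center that(4) by blast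
  qed
qed

lemma adj_T_sym:
  assumes "adj T x y"
  shows "adj T y x"
  using assms
proof (cases rule: adj_T_cases)
  case 1
  then show ?thesis using adj_W[OF h_W[of x], of x] by simp
next
  case 2
  then show ?thesis using adj_leaf[of y x] by simp
next
  case 3
  then show ?thesis using adj_center[of x] by simp
next
  case 4
  then show ?thesis using adj_W[of y "n + 3"] by simp
qed

lemma rotation_system_T: "rotation_system T"
  unfolding rotation_system_def
proof (intro conjI ballI allI impI)
  show "finite (verts T)" unfolding verts_T by simp
  show "distinct (bd T)" "blacks T \<inter> whites T = {}" unfolding T_simps by simp_all
  show "set (bd T) \<inter> internal T = {}" unfolding internal_def T_simps by auto
next
  fix v assume "v \<in> verts T"
  then consider "v < n" | "v = n" | "v = n + 1" | "v = n + 2" | "v = n + 3"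
    unfolding verts_T by blast
  then show "distinct (rot T v)"
  proof cases
    case 2
    have "q \<le> p + n" "q < n" using pq by linarith+
    then show ?thesis unfolding 2 rot_T using distinct_arc by (simp add: set_arc)
  next
    case 3
    have "r \<le> q + n" "r < n" using pq by linarith+
    then show ?thesis unfolding 3 rot_T using distinct_arc by (simp add: set_arc)
  next
    case 4
    have "n + p \<le> r + n" "p < r" using pq by linarith+
    then show ?thesis unfolding 4 rot_T using distinct_arc pq by (simp add: set_arc_wrap)
  qed (simp_all add: rot_T)
next
  fix v assume v: "v \<in> verts T"
  show "set (rot T v) \<subseteq> verts T - {v}"
  proof
    fix y assume "y \<in> set (rot T v)"
    then have a: "adj T v y" using v by (simp add: adj_def)
    then have "y \<in> verts T" using adj_T_sym[OF a] by (simp add: adj_def)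
    moreover have "y \<noteq> v" using a by (cases rule: adj_T_cases) (use h_W[of v] h_W[of y] in auto)
    ultimately show "y \<in> verts T - {v}" by simp
  qed
next
  fix u v show "adj T u v \<Longrightarrow> adj T v u" by (rule adj_T_sym)
qed

lemma side_leaf:
  assumes "x < n"
  shows "side T x (h x) = {x}"
proof -
  have "y = x" if "y \<in> side T x (h x)" for y
    using that
  proof (induction rule: side_induct)
    case (step y z)
    then have "z = h x" using adj_leaf[OF assms, of z] by simp
    then show ?case using step.IH step.hyps(3) by simp
  qed simp
  then show ?thesis using side_refl[of x T "h x"] by blast
qed

lemma side_W:
  assumes "a \<in> W"
  shows "side T a (n + 3) = insert a (L a)"
proof -
  have "y = a \<or> y \<in> L a" if "y \<in> side T a (n + 3)" for y
    using that
  proof (induction rule: side_induct)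
    case (step y z)
    from step.IH show ?case
    proof
      assume "y = a"
      then have "z = n + 3 \<or> z \<in> L a" using step.hyps(2) adj_W[OF assms, of z] by simp
      then show ?thesis using step.hyps(3) \<open>y = a\<close> by blast
    next
      assume "y \<in> L a"
      then show ?thesis using step.hyps(2) adj_leaf[of y z] by simp
    qed
  qed simp
  moreover have "y \<in> side T a (n + 3)" if "y \<in> L a" for y
  proof (rule side_step[OF side_refl])
    show "adj T a y" using adj_W[OF assms, of y] that by blast
    have "a \<noteq> n + 3" "y \<noteq> n + 3" using assms that by auto
    then show "{a, y} \<noteq> {a, n + 3}" by (rule doubleton_neq)
  qed
  ultimately show ?thesis using side_refl[of a T "n + 3"] by blast
qed

text \<open>Every edge has an end whose side is explicit, a leaf alone or a hub with its leaves;
  \<open>side_swap\<close> moves the claim to that end.\<close>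

lemma bridges_T: "adj T u v \<Longrightarrow> v \<notin> side T u v"
proof
  assume a: "adj T u v" and s: "v \<in> side T u v"
  note s' = side_swap[OF rotation_system_T s]
  from a show False
  proof (cases rule: adj_T_cases)
    case 1
    then show ?thesis using s side_leaf h_W[of u] by auto
  next
    case 2
    then show ?thesis using s' side_leaf h_W[of v] by auto
  next
    case 3
    then show ?thesis using s side_W by auto
  next
    case 4
    then show ?thesis using s' side_W by auto
  qed
qed

lemma is_tree_T: "is_tree T"
proof -
  have to: "(adj T)\<^sup>*\<^sup>* x (n + 3)" if xT: "x \<in> verts T" for x
  proof -
    have W: "(adj T)\<^sup>*\<^sup>* a (n + 3)" if "a \<in> W" for a
      using adj_W[OF that, of "n + 3"] by (intro r_into_rtranclp) simp
    consider "x < n" | "x \<in> W" | "x = n + 3" using xT unfolding verts_T by blast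
    then show ?thesis
    proof cases
      case 1
      then have "adj T x (h x)" using adj_leaf[of x "h x"] by simp
      then show ?thesis using W[OF h_W] by (rule converse_rtranclp_into_rtranclp)
    next
      case 2
      then show ?thesis by (rule W)
    next
      case 3
      then show ?thesis by simp
    qed
  qed
  have sym: "symp ((adj T)\<^sup>*\<^sup>*)" by (rule symp_rtranclp, rule sympI, rule adj_T_sym)
  have "(adj T)\<^sup>*\<^sup>* x y" if "x \<in> verts T" "y \<in> verts T" for x y
    using to[OF that(1)] sympD[OF sym to[OF that(2)]] by (rule rtranclp_trans)
  moreover have "verts T \<noteq> {}" unfolding verts_T by simp
  ultimately show ?thesis
    using acyclic_iff_bridges[OF rotation_system_T] bridges_T by (simp add: is_tree_def)
qed

lemma boundary_clockwise_T: "boundary_clockwise T"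
  unfolding boundary_clockwise_iff_step
proof (intro allI impI)
  fix i assume "i < length (bd T)"
  then have i: "i < n" by (simp add: T_simps)
  then have bd: "bd T ! i = i" "bd T ! (Suc i mod length (bd T)) = Suc i mod n"
    by (simp_all add: T_simps)
  have nb: "x \<notin> set (bd T)" if "x \<ge> n" for x using that by (simp add: T_simps)
  have direct: "(step T)\<^sup>*\<^sup>* (i, h i) (h i, j)" if "cw_next (rot T (h i)) i j" for j
  proof -
    have "h i \<notin> set (bd T)" by (rule nb) (simp add: hub_def)
    then have "step T (i, h i) (h i, j)" using that by simp
    then show ?thesis by blast
  qed
  have via: "(step T)\<^sup>*\<^sup>* (i, h i) (a, j)"
    if "cw_next (rot T (h i)) i (n + 3)" "cw_next (rot T (n + 3)) (h i) a" "cw_next (rot T a) (n + 3) j" "a \<ge> n" for a j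
  proof -
    have "step T (h i, n + 3) (n + 3, a)" "step T (n + 3, a) (a, j)"
      using that nb by simp_all
    with direct[OF that(1)] show ?thesis by (metis rtranclp.rtrancl_into_rtrancl)
  qed
  have tri: "cw_next (rot T (n + 3)) n (n + 1)" "cw_next (rot T (n + 3)) (n + 1) (n + 2)"
    "cw_next (rot T (n + 3)) (n + 2) n"
    using cw_next_append[of "[]" n "n + 1" "[n + 2]"] cw_next_append[of "[n]" "n + 1" "n + 2" "[]"]
      cw_next_wrap[of n "[n + 1]" "n + 2"] by (simp_all add: rot_T)
  have "\<exists>y. (step T)\<^sup>*\<^sup>* (i, h i) (y, Suc i mod n)"
  proof -
    have m: "i mod n = i" "(n + i) mod n = i" "Suc (n + i) mod n = Suc i mod n"
      using i mod_add_self1[of n "Suc i"] by simp_all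
    \<comment> \<open>Inside an arc the face turns at the hub only; at the cuts \<open>p\<close>,
      \<open>q\<close>, \<open>r\<close> it passes through the centre. The labels below
      \<open>p\<close> belong to the arc that starts after \<open>r\<close> and are met there as
      \<open>n + i\<close>.\<close>
    consider "p < i" "i < q" | "q < i" "i < r" | "r < i" | "i < p" | "i = p" | "i = q" | "i = r"
      by linarith
    then show ?thesis
    proof cases
      case 1
      then have hi: "h i = n" by (simp add: hub_def)
      have "cw_next (rot T (h i)) i (Suc i mod n)"
        using cw_next_arc[OF 1, of n "n + 3"] by (simp only: hi rot_T(2-5) m)
      from direct[OF this] show ?thesis by blast
    next
      case 2
      then have hi: "h i = n + 1" by (simp add: hub_def)
      have "cw_next (rot T (h i)) i (Suc i mod n)"
        using cw_next_arc[OF 2, of n "n + 3"] by (simp only: hi rot_T(2-5) m)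
      from direct[OF this] show ?thesis by blast
    next
      case 3
      then have hi: "h i = n + 2" using pq by (simp add: hub_def)
      have "i < n + p" using i by simp
      from cw_next_arc[OF 3 this, of n "n + 3"] have "cw_next (rot T (h i)) i (Suc i mod n)"
        by (simp only: hi rot_T(2-5) m)
      from direct[OF this] show ?thesis by blast
    next
      case 4
      then have hi: "h i = n + 2" using pq by (simp add: hub_def)
      have "r < n + i" "n + i < n + p" using 4 pq by linarith+
      from cw_next_arc[OF this, of n "n + 3"] have "cw_next (rot T (h i)) i (Suc i mod n)"
        by (simp only: hi rot_T(2-5) m)
      from direct[OF this] show ?thesis by blast
    next
      case 5
      then have hi: "h i = n + 2" using pq by (simp add: hub_def)
      have lt: "r < n + p" using pq by linarith
      have "(n + p) mod n = p" using m 5 by simp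
      from cw_next_arc_last[OF lt, of n "n + 3"] have a: "cw_next (rot T (h i)) i (n + 3)"
        using \<open>(n + p) mod n = p\<close> by (simp only: 5 hi[unfolded 5] rot_T(2-5))
      have b: "cw_next (rot T n) (n + 3) (Suc i mod n)"
        unfolding rot_T(2-5) 5 by (rule cw_next_arc_first[OF pq(1)])
      from via[OF a _ b] show ?thesis using tri(3) hi by auto
    next
      case 6
      then have hi: "h i = n" using pq by (simp add: hub_def)
      have "q mod n = q" using m 6 by simp
      from cw_next_arc_last[OF pq(1), of n "n + 3"] have a: "cw_next (rot T (h i)) i (n + 3)"
        using \<open>q mod n = q\<close> by (simp only: 6 hi[unfolded 6] rot_T(2-5))
      have b: "cw_next (rot T (n + 1)) (n + 3) (Suc i mod n)"
        unfolding rot_T(2-5) 6 by (rule cw_next_arc_first[OF pq(2)])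
      from via[OF a _ b] show ?thesis using tri(1) hi by auto
    next
      case 7
      then have hi: "h i = n + 1" using pq by (simp add: hub_def)
      have "r mod n = r" using m 7 by simp
      from cw_next_arc_last[OF pq(2), of n "n + 3"] have a: "cw_next (rot T (h i)) i (n + 3)"
        using \<open>r mod n = r\<close> by (simp only: 7 hi[unfolded 7] rot_T(2-5))
      have "r < n + p" using pq by linarith
      then have b: "cw_next (rot T (n + 2)) (n + 3) (Suc i mod n)"
        unfolding rot_T(2-5) 7 by (rule cw_next_arc_first)
      from via[OF a _ b] show ?thesis using tri(2) hi by auto
    qed
  qed
  then show "\<exists>x y. adj T (bd T ! i) x \<and>
    (step T)\<^sup>*\<^sup>* (bd T ! i, x) (y, bd T ! (Suc i mod length (bd T)))"
    unfolding bd using adj_leaf[OF i] by blast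
qed

lemma plabic_tree_T: "plabic_tree T"
proof -
  have "deg T v = 1" if "v \<in> set (bd T)" for v
    using that by (simp add: T_simps deg_def rot_T)
  moreover have "deg T v \<noteq> 1" if vi: "v \<in> internal T" for v
  proof -
    consider "v = n" | "v = n + 1" | "v = n + 2" | "v = n + 3"
      using vi unfolding internal_def T_simps by blast
    then show ?thesis
    proof cases
      case 1
      then show ?thesis using pq by (simp add: deg_def rot_T(2) length_arc)
    next
      case 2
      have "deg T v = Suc (r - q)" unfolding 2 deg_def rot_T by (simp add: length_arc)
      then show ?thesis using pq by simp
    next
      case 3
      have "deg T v = Suc (n + p - r)" unfolding 3 deg_def rot_T by (simp add: length_arc)
      then show ?thesis using pq by simp
    next
      case 4
      then show ?thesis by (simp add: deg_def rot_T(5))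
    qed
  qed
  ultimately show ?thesis
    using rotation_system_T is_tree_T boundary_clockwise_T by (simp add: plabic_tree_def)
qed

lemma bipartite_T: "bipartite T"
  unfolding bipartite_def
proof (intro allI impI)
  fix u v assume "adj T u v"
  then show "(u \<in> set (bd T) \<union> blacks T) \<noteq> (v \<in> set (bd T) \<union> blacks T)"
    unfolding T_simps by (cases rule: adj_T_cases) (use h_W[of u] h_W[of v] in auto)
qed

lemma deg_center: "deg T (n + 3) = 3"
  by (simp add: deg_def rot_T)

lemma excess_T: "excess T = 1"
  by (simp add: excess_def T_simps deg_center)

lemma branching_T: "branching T = {n + 3}"
  by (auto simp: branching_def T_simps deg_center)

lemma load_leaf: "x < n \<Longrightarrow> load m T x (h x) = 1"
  by (simp add: load_def side_leaf T_simps)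

lemma load_W: "a \<in> W \<Longrightarrow> load m T a (n + 3) = int (card (L a))"
proof -
  assume a: "a \<in> W"
  have "{0..<n} \<inter> insert a (L a) = L a" "insert a (L a) \<inter> {n + 3} = {}" using a by auto
  then show ?thesis unfolding load_def side_W[OF a] T_simps by simp
qed

lemma card_L: "card (L n) = q - p" "card (L (n + 1)) = r - q" "card (L (n + 2)) = n + p - r"
proof -
  show "card (L n) = q - p" "card (L (n + 1)) = r - q" unfolding L_eq by simp_all
  have "card ({..p} \<union> {r<..<n}) = card {..p} + card {r<..<n}"
    using pq by (intro card_Un_disjoint) auto
  then show "card (L (n + 2)) = n + p - r" unfolding L_eq using pq by simp
qed

text \<open>At a leaf the load is 1, and at a hub it counts the leaves of that hub. By
  \<open>load_swap\<close> the two loads of an edge add up to \<open>m + 1\<close>, so the opposite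
  ones lie in the same range.\<close>

lemma balanced_T:
  assumes n: "n = 2 * m + 1" and m: "\<And>a. a \<in> W \<Longrightarrow> card (L a) \<le> m"
  shows "balanced m T"
  unfolding balanced_iff_load
proof (intro allI impI)
  fix u v assume a: "adj T u v"
  have "m \<ge> 1" using n pq by linarith
  have swap: "load m T u v + load m T v u = int m + 1"
  proof -
    have "length (bd T) = n" by (simp add: T_simps)
    then have "int (length (bd T)) = 2 * int m + 1" using n by linarith
    then show ?thesis
      using load_swap[OF plabic_tree_T a, of m] unfolding excess_T by linarith
  qed
  have pos: "card (L a) \<ge> 1" if "a \<in> W" for a
  proof -
    from that consider "a = n" | "a = n + 1" | "a = n + 2" by blast
    then show ?thesis by cases (use pq card_L in simp_all)
  qed
  from a show "1 \<le> load m T u v \<and> load m T u v \<le> int m"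
  proof (cases rule: adj_T_cases)
    case 1
    then show ?thesis using load_leaf[of u m] \<open>m \<ge> 1\<close> by simp
  next
    case 2
    then have "load m T v u = 1" using load_leaf[of v m] by simp
    then show ?thesis using swap \<open>m \<ge> 1\<close> by simp
  next
    case 3
    then have "load m T u v = int (card (L u))" using load_W by simp
    then show ?thesis using m[OF 3(1)] pos[OF 3(1)] by simp
  next
    case 4
    then have "load m T v u = int (card (L v))" using load_W by simp
    then show ?thesis using swap m[OF 4(2)] pos[OF 4(2)] by simp
  qed
qed

lemma linked_T:
  assumes "i < n" "j < n"
  shows "linked T i j \<longleftrightarrow> h i = h j"
proof
  assume "linked T i j"
  then have "j = h i \<or> j < n \<and> h j = h i"
  proof (induction rule: linked_induct)
    case (step y z)
    from step.IH show ?case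
    proof
      assume y: "y = h i"
      have "z \<noteq> n + 3" using step.hyps(4) unfolding branching_T by simp
      then have "z \<in> L (h i)" using step.hyps(2) adj_W[OF h_W, of i z] unfolding y by simp
      then show ?thesis by simp
    next
      assume "y < n \<and> h y = h i"
      then show ?thesis using step.hyps(2) adj_leaf[of y z] by simp
    qed
  qed (use assms in simp)
  moreover have "n \<le> h i" by (simp add: hub_def)
  ultimately show "h i = h j" using assms by linarith
next
  assume e: "h i = h j"
  have nb: "i \<notin> branching T" "j \<notin> branching T" using assms by (simp_all add: branching_T)
  have hb: "h i \<notin> branching T" by (simp add: branching_T hub_def)
  have a1: "adj T i (h i)" using adj_leaf[OF assms(1)] by blast
  have a2: "adj T (h i) j" unfolding e by (rule adj_T_sym) (use adj_leaf[OF assms(2)] in blast)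
  show "linked T i j"
    by (rule linked_step[OF linked_step[OF linked_refl a1 nb(1) hb] a2 hb nb(2)])
qed

lemma links_T: "links T = {(i, j). i < n \<and> j < n \<and> h i = h j}"
  using linked_T by (auto simp: links_def T_simps)

text \<open>The parameters are recovered from the invariant, as the labels whose successor lies in
  another class. Thus \<open>links\<close> separates tripods.\<close>

lemma cuts_T: "{i. i < n \<and> (i, Suc i mod n) \<notin> links T} = {p, q, r}"
proof -
  have n: "0 < n" using pq by simp
  have "h i \<noteq> h (Suc i mod n) \<longleftrightarrow> i = p \<or> i = q \<or> i = r" if i: "i < n" for i
  proof (cases "Suc i = n")
    \<comment> \<open>The successor is 0, which lies in the arc through \<open>p\<close>; the last
      label lies there too unless it is \<open>r\<close>.\<close>
    case True
    then show ?thesis using pq by (auto simp: hub_def)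
  next
    case False
    then have "Suc i mod n = Suc i" using i by simp
    then show ?thesis using pq i by (auto simp: hub_def)
  qed
  then show ?thesis using pq n unfolding links_T by auto
qed

end

subsection \<open>Counting\<close>

text \<open>Tripod parameters for \<open>2 * m + 1\<close> labels with all arcs of length at most
  \<open>m\<close>; \<open>2 * m + 1 + p - r\<close> is the length of the arc that contains label
  0.\<close>

definition triples :: "nat \<Rightarrow> (nat \<times> nat \<times> nat) set" where
  "triples m = {(p, q, r). p < q \<and> q < r \<and> r < 2 * m + 1 \<and>
     q - p \<le> m \<and> r - q \<le> m \<and> 2 * m + 1 + p - r \<le> m}"

text \<open>With \<open>j = 2 * m + 1 - (r - p)\<close>, there are \<open>j\<close> choices for \<open>p\<close> and, independently, \<open>j\<close> for \<open>q\<close>.\<close>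

lemma bij_betw_triples:
  "bij_betw (\<lambda>(j, a, t). (a, a + (m + 1 - j) + t, a + (2 * m + 1 - j)))
     (SIGMA j:{1..m}. {..<j} \<times> {..<j}) (triples m)"
\<comment> \<open>Since \<open>r = p + (2 * m + 1 - j)\<close>, the condition
  \<open>r < 2 * m + 1\<close> says \<open>p < j\<close>. The bounds on the other two arcs put
  \<open>q\<close> between \<open>r - m\<close> and \<open>p + m\<close>, an interval of
  \<open>j\<close> values; \<open>t\<close> is the offset of \<open>q\<close> from
  \<open>r - m\<close>.\<close>
proof (rule bij_betw_byWitness[where f' = "\<lambda>(p, q, r). (2 * m + 1 + p - r, p, q - p - (r - p - m))"])
  show "\<forall>x\<in>SIGMA j:{1..m}. {..<j} \<times> {..<j}.
      (case case x of (j, a, t) \<Rightarrow> (a, a + (m + 1 - j) + t, a + (2 * m + 1 - j)) of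
        (p, q, r) \<Rightarrow> (2 * m + 1 + p - r, p, q - p - (r - p - m))) = x"
    by auto
  show "\<forall>x\<in>triples m.
      (case case x of (p, q, r) \<Rightarrow> (2 * m + 1 + p - r, p, q - p - (r - p - m)) of
        (j, a, t) \<Rightarrow> (a, a + (m + 1 - j) + t, a + (2 * m + 1 - j))) = x"
    by (auto simp: triples_def)
  show "(\<lambda>(j, a, t). (a, a + (m + 1 - j) + t, a + (2 * m + 1 - j))) `
      (SIGMA j:{1..m}. {..<j} \<times> {..<j}) \<subseteq> triples m"
    by (auto simp: triples_def)
  show "(\<lambda>(p, q, r). (2 * m + 1 + p - r, p, q - p - (r - p - m))) ` triples m
      \<subseteq> (SIGMA j:{1..m}. {..<j} \<times> {..<j})"
    by (auto simp: triples_def)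
qed

lemma finite_triples: "finite (triples m)"
  using bij_betw_finite[OF bij_betw_triples[of m]] by simp

lemma card_triples: "card (triples m) = (\<Sum>i = 1..m. i ^ 2)"
proof -
  have "card (triples m) = card (SIGMA j:{1..m}. {..<j} \<times> {..<j})"
    using bij_betw_same_card[OF bij_betw_triples] by simp
  also have "\<dots> = (\<Sum>i = 1..m. i ^ 2)" by (simp add: power2_eq_square)
  finally show ?thesis .
qed

lemma sum_squares: "real (\<Sum>i = 1..m. i ^ 2) = real m * (real m + 1) * (2 * real m + 1) / 6"
  by (induction m) (simp_all add: field_simps power2_eq_square)

lemma tripod_params_triples: "(p, q, r) \<in> triples m \<Longrightarrow> tripod_params (2 * m + 1) p q r"
  by (simp add: triples_def tripod_params_def)

section \<open>The classes correspond to the triples\<close>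

lemma amplitree_tripod:
  assumes "(p, q, r) \<in> triples m"
  shows "amplitree 2 m (tripod (2 * m + 1) p q r)"
proof -
  interpret tripod_params "2 * m + 1" p q r by (rule tripod_params_triples[OF assms])
  have t: "q - p \<le> m" "r - q \<le> m" "2 * m + 1 + p - r \<le> m" using assms by (auto simp: triples_def)
  have "balanced m T"
  proof (rule balanced_T[OF refl])
    fix a assume "a \<in> W"
    then consider "a = 2 * m + 1" | "a = 2 * m + 1 + 1" | "a = 2 * m + 1 + 2" by blast
    then show "card (L a) \<le> m"
      by cases (use card_L t in \<open>simp_all only:\<close>)
  qed
  moreover have "length (bd T) = 2 * m + 1" by (simp only: T_simps length_upt diff_zero)
  then have "has_type T 2 (2 * m + 1)"
    using excess_T by (simp add: has_type_def excess_def)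
  ultimately show ?thesis using plabic_tree_T bipartite_T by (simp add: amplitree_def)
qed

lemma amplitree_2D:
  assumes "amplitree 2 m G"
  shows "plabic_tree G" "bipartite G" "excess G = 1" "length (bd G) = 2 * m + 1" "bd G \<noteq> []"
  using assms by (auto simp: amplitree_def has_type_def excess_def)

text \<open>Excess and bipartiteness make the reduced tree \<open>K\<close> a tripod; the bounds on
  its arcs come from \<open>card_links_le\<close> for the original \<open>G\<close>, whose
  \<open>links\<close> agree with those of the tripod.\<close>

lemma amplitree_move_equiv_tripod:
  assumes G: "amplitree 2 m G"
  obtains p q r where "(p, q, r) \<in> triples m" "move_equiv G (tripod (2 * m + 1) p q r)"
proof -
  note G' = amplitree_2D[OF G]
  obtain K where K: "plabic_tree K" "bipartite K" "move_equiv G K" "\<forall>v\<in>blacks K. deg K v \<noteq> 2"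
    using remove_all_black_deg2[OF G'(1,2,5)] by blast
  have lK: "length (bd K) = 2 * m + 1"
    using move_equiv_invariants(1)[OF K(3)] G'(4) by (rule trans)
  have exK: "excess K = 1" using move_equiv_invariants(2)[OF K(3)] G'(3) by (rule trans)
  have neK: "bd K \<noteq> []" using lK by force
  obtain b where b: "b \<in> blacks K" "deg K b = 3" "branching K = {b}"
    "\<And>x. x \<in> blacks K \<Longrightarrow> x \<noteq> b \<Longrightarrow> deg K x = 2"
    using excess_1[OF K(1) neK exK] by blast
  have "blacks K = {b}"
  proof (intro equalityI subsetI)
    fix x assume "x \<in> blacks K"
    then show "x \<in> {b}" using b(4) K(4) by auto
  qed (use b(1) in simp)
  then interpret S: star K b using K(1,2) neK b(2) by (simp add: star_def)
  obtain p q r where pqr: "p < q" "q < r" "r < 2 * m + 1" "isotopic (tripod (2 * m + 1) p q r) K"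
    by (rule S.isotopic_tripod[unfolded lK])
  interpret tripod_params "2 * m + 1" p q r by unfold_locales (fact pqr)+
  have "move_equiv T K" by (rule move_equivI[OF plabic_tree_T K(1) disjI1[OF pqr(4)]])
  then have GT: "move_equiv G T" by (rule move_equiv_trans[OF K(3) move_equiv_sym])
  have links: "links T = links G" using move_equiv_invariants(3)[OF GT G'(5,3)] .
  have le: "card (L (h i)) \<le> m" if i: "i < 2 * m + 1" for i
  proof -
    have eq: "{j. (i, j) \<in> links T} = L (h i)"
    proof (rule Collect_cong)
      fix j
      show "(i, j) \<in> links T \<longleftrightarrow> j < 2 * m + 1 \<and> h j = h i"
        unfolding links_T mem_Collect_eq prod.case using i by metis
    qed
    have "i < length (bd G)" unfolding G'(4) by (rule i)
    then have "card {j. (i, j) \<in> links T} \<le> m" unfolding links by (rule card_links_le[OF G])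
    then show ?thesis unfolding eq .
  qed
  \<comment> \<open>One label from each arc, so that \<open>le\<close> bounds all three
    lengths.\<close>
  have h: "h q = 2 * m + 1" "h r = 2 * m + 1 + 1" "h p = 2 * m + 1 + 2"
    using pqr by (simp_all add: hub_def)
  have lt: "q < 2 * m + 1" "p < 2 * m + 1" using pqr by linarith+
  have "q - p \<le> m" "r - q \<le> m" "2 * m + 1 + p - r \<le> m"
    using le[OF lt(1)] le[OF pqr(3)] le[OF lt(2)] unfolding h card_L by - assumption+
  then have "(p, q, r) \<in> triples m" using pqr by (simp add: triples_def)
  then show ?thesis using that GT by blast
qed

lemma move_equiv_tripods:
  assumes "(p, q, r) \<in> triples m" "(p', q', r') \<in> triples m"
    "move_equiv (tripod (2 * m + 1) p q r) (tripod (2 * m + 1) p' q' r')"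
  shows "(p, q, r) = (p', q', r')"
proof -
  interpret A: tripod_params "2 * m + 1" p q r by (rule tripod_params_triples[OF assms(1)])
  interpret B: tripod_params "2 * m + 1" p' q' r' by (rule tripod_params_triples[OF assms(2)])
  have "bd A.T \<noteq> []" unfolding A.T_simps by simp
  from move_equiv_invariants(3)[OF assms(3) this A.excess_T] have l: "links B.T = links A.T" .
  have "{p, q, r} = {p', q', r'}"
    using A.cuts_T[symmetric] B.cuts_T unfolding l by (rule trans)
  then have "set [p, q, r] = set [p', q', r']" by simp
  moreover have "sorted_wrt (<) [p, q, r]" "sorted_wrt (<) [p', q', r']"
    using A.pq B.pq by simp_all
  ultimately have "[p, q, r] = [p', q', r']" by (intro strict_sorted_equal)
  then show ?thesis by simp
qed

lemma amplitree_classes_2: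
  "amplitree_classes 2 m =
     (\<lambda>(p, q, r). {H. amplitree 2 m H \<and> move_equiv (tripod (2 * m + 1) p q r) H}) ` triples m"
  (is "_ = ?f ` _")
proof -
  let ?A = "{G :: nat plabic. amplitree 2 m G}"
  let ?R = "{(G, H). amplitree 2 m G \<and> amplitree 2 m H \<and> move_equiv G H} :: nat plabic rel"
  have img: "?R `` {G} = {H. amplitree 2 m H \<and> move_equiv G H}" if "amplitree 2 m G" for G
    using that by simp
  have "X \<in> ?A // ?R \<longleftrightarrow> X \<in> ?f ` triples m" for X
  proof
    assume "X \<in> ?A // ?R"
    then obtain G where "G \<in> ?A" "X = ?R `` {G}" by (rule quotientE)
    then have G: "amplitree 2 m G" "X = {H. amplitree 2 m H \<and> move_equiv G H}" using img by simp_all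
    obtain p q r where t: "(p, q, r) \<in> triples m" "move_equiv G (tripod (2 * m + 1) p q r)"
      by (rule amplitree_move_equiv_tripod[OF G(1)])
    have "move_equiv G H \<longleftrightarrow> move_equiv (tripod (2 * m + 1) p q r) H" for H
      using move_equiv_trans[OF t(2)] move_equiv_trans[OF move_equiv_sym[OF t(2)]] by (rule iffI[rotated])
    then have "X = ?f (p, q, r)" unfolding G(2) by simp
    then show "X \<in> ?f ` triples m" using t(1) by (rule image_eqI)
  next
    assume "X \<in> ?f ` triples m"
    then obtain p q r where t: "(p, q, r) \<in> triples m" "X = ?f (p, q, r)" by auto
    note a = amplitree_tripod[OF t(1)]
    have "?R `` {tripod (2 * m + 1) p q r} \<in> ?A // ?R" by (rule quotientI) (simp only: mem_Collect_eq a)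
    then show "X \<in> ?A // ?R" unfolding img[OF a] t(2) by simp
  qed
  then show ?thesis unfolding amplitree_classes_def by (intro set_eqI)
qed

lemma inj_on_classes:
  "inj_on (\<lambda>(p, q, r). {H. amplitree 2 m H \<and> move_equiv (tripod (2 * m + 1) p q r) H}) (triples m)"
  (is "inj_on ?f _")
proof (rule inj_onI)
  fix x y assume t: "x \<in> triples m" "y \<in> triples m" and e: "?f x = ?f y"
  obtain p q r p' q' r' where xy: "x = (p, q, r)" "y = (p', q', r')" by (cases x, cases y) blast
  have "tripod (2 * m + 1) p' q' r' \<in> ?f y"
    unfolding xy prod.case mem_Collect_eq
    by (rule conjI[OF amplitree_tripod[OF t(2)[unfolded xy]] move_equiv_refl])
  then have "tripod (2 * m + 1) p' q' r' \<in> ?f x" unfolding e .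
  then have "move_equiv (tripod (2 * m + 1) p q r) (tripod (2 * m + 1) p' q' r')"
    unfolding xy prod.case mem_Collect_eq by (rule conjunct2)
  from move_equiv_tripods[OF t[unfolded xy] this] show "x = y" unfolding xy .
qed

lemma c_2: "c 2 m = (\<Sum>i = 1..m. i ^ 2)"
  unfolding c_def amplitree_classes_2 card_image[OF inj_on_classes] by (rule card_triples)

lemma finite_amplitree_classes_2: "finite (amplitree_classes 2 m)"
  unfolding amplitree_classes_2 by (rule finite_imageI[OF finite_triples])

section \<open>The generating function\<close>

lemma fps_mult_1_minus_X_nth:
  "fps_nth (F * (1 - fps_X)) n = fps_nth F n - (if n = 0 then 0 else fps_nth F (n - 1))"
  for F :: "real fps"
  by (simp add: right_diff_distrib)

text \<open>Multiplication by \<open>1 - fps_X\<close> takes backward differences. Four of them lead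
  from the sums of squares to the squares, the odd numbers, the sequence 1, 2, 2, ... and finally
  \<open>1 + fps_X\<close>.\<close>

lemma fps_squares_sum:
  "Abs_fps (\<lambda>m. real (\<Sum>i = 1..m + 1. i ^ 2)) = (1 + fps_X) / (1 - fps_X) ^ 4"
proof -
  let ?F = "Abs_fps (\<lambda>m. real (\<Sum>i = 1..m + 1. i ^ 2))" and ?D = "1 - fps_X :: real fps"
  have 1: "?F * ?D = Abs_fps (\<lambda>n. (real n + 1) ^ 2)"
  proof (rule fps_ext)
    fix n
    show "fps_nth (?F * ?D) n = fps_nth (Abs_fps (\<lambda>n. (real n + 1) ^ 2)) n"
      by (cases n) (simp_all add: fps_mult_1_minus_X_nth add_ac)
  qed
  have 2: "Abs_fps (\<lambda>n. (real n + 1) ^ 2) * ?D = Abs_fps (\<lambda>n. 2 * real n + 1)"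
    by (rule fps_ext) (auto simp: fps_mult_1_minus_X_nth power2_eq_square algebra_simps of_nat_diff)
  have 3: "Abs_fps (\<lambda>n. 2 * real n + 1) * ?D = Abs_fps (\<lambda>n. if n = 0 then 1 else 2)"
    by (rule fps_ext) (auto simp: fps_mult_1_minus_X_nth of_nat_diff)
  have 4: "Abs_fps (\<lambda>n. if n = 0 then 1 else 2) * ?D = 1 + fps_X"
    by (rule fps_ext) (auto simp: fps_mult_1_minus_X_nth fps_X_nth)
  have "?F * ?D ^ 4 = ?F * ?D * ?D * ?D * ?D" by (simp add: numeral_eq_Suc mult.assoc)
  also have "\<dots> = 1 + fps_X" by (simp only: 1 2 3 4)
  finally have "?F * ?D ^ 4 = 1 + fps_X" .
  moreover have "?D \<noteq> 0" by (auto dest: arg_cong[where f = "\<lambda>f. fps_nth f 0"])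
  then have "?D ^ 4 \<noteq> 0" by simp
  ultimately show ?thesis by (metis nonzero_mult_div_cancel_right)
qed

theorem theorem7p24:
  shows "(\<forall>m::nat. m \<ge> 1 \<longrightarrow>
            finite (amplitree_classes 2 m) \<and>
            c 2 m = (\<Sum>i=1..m. i ^ 2) \<and>
            real (c 2 m) = real m * (real m + 1) * (2 * real m + 1) / 6) \<and>
         Abs_fps (\<lambda>m. real (c 2 (m + 1))) = (1 + fps_X) / (1 - fps_X) ^ 4"
  using finite_amplitree_classes_2 sum_squares fps_squares_sum unfolding c_2 by blast

end
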